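(* Let $K$ be an algebraically closed field of characteristic different from $2$ and $3$. Any decomposable associative Jacobi-Jordan algebra of dimension $5$ over $K$ is isomorphic to exactly one of the following $7$ algebras, each given by a basis $(e_1,\ldots,e_5)$ and the listed products: \begin{itemize} \item $A_{0,1}^5$: all products zero; \item $A_{1,2}\oplus A_{0,1}^3$: $e_1\cdot e_1=e_2$; \item $A_{1,3}\oplus A_{0,1}^2$: $e_1\cdot e_1=e_2$, $e_3\cdot e_3=e_2$; \item $A_{2,4}\oplus A_{0,1}$: $e_1\cdot e_1=e_2$, $e_3\cdot e_4=e_4\cdot e_3=e_2$; \item $A_{1,2}^2\oplus A_{0,1}$: $e_1\cdot e_1=e_2$, $e_3\cdot e_3=e_4$; \item $A_{1,2}\oplus A_{1,3}$: $e_1\cdot e_1=e_2$, $e_3\cdot e_3=e_4$, $e_5\cdot e_5=e_4$; \item $A_{1,4}\oplus A_{0,1}$: $e_1\cdot e_1=e_2$, $e_1\cdot e_3=e_3\cdot e_1=e_4$. \end{itemize}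
   Context: An algebra over a field $K$ is a $K$-vector space with a bilinear product $x\cdot y$; neither associativity nor a unit is assumed. A Jacobi-Jordan algebra is an algebra $A$ over $K$ satisfying $x\cdot y=y\cdot x$ and $x\cdot(y\cdot z)+y\cdot(z\cdot x)+z\cdot(x\cdot y)=0$ for all $x,y,z\in A$. An algebra is decomposable if it is isomorphic to a direct sum of two nonzero algebras. Products of basis vectors that are not listed are zero. The names refer to the following algebras (second index = dimension): $A_{0,1}$ is the $1$-dimensional algebra with zero product; $A_{1,2}$ has basis $e_1,e_2$ with $e_1\cdot e_1=e_2$; $A_{1,3}$ has basis $e_1,e_2,e_3$ with $e_1\cdot e_1=e_3\cdot e_3=e_2$; $A_{1,4}$ has basis $e_1,\ldots,e_4$ with $e_1\cdot e_1=e_2$, $e_1\cdot e_3=e_3\cdot e_1=e_4$; $A_{2,4}$ has basis $e_1,\ldots,e_4$ with $e_1\cdot e_1=e_2$, $e_3\cdot e_4=e_4\cdot e_3=e_2$. *)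

theory Defs
  imports "HOL-Analysis.Analysis"
begin

text \<open>
  An algebra is given by a vector space structure \<open>s\<close> on an ambient type, a subspace \<open>A\<close> of it
  as carrier, and a product \<open>m\<close> that is only constrained on \<open>A\<close>.
\<close>

locale nonassoc_algebra = vector_space s
  for s :: "'k::field \<Rightarrow> 'v::ab_group_add \<Rightarrow> 'v" +
  fixes A :: "'v set" and m :: "'v \<Rightarrow> 'v \<Rightarrow> 'v"
  assumes subspace_carrier: "subspace A"
    and mult_closed: "x \<in> A \<Longrightarrow> y \<in> A \<Longrightarrow> m x y \<in> A"
    and mult_add_left: "x \<in> A \<Longrightarrow> y \<in> A \<Longrightarrow> z \<in> A \<Longrightarrow> m (x + y) z = m x z + m y z"
    and mult_add_right: "x \<in> A \<Longrightarrow> y \<in> A \<Longrightarrow> z \<in> A \<Longrightarrow> m x (y + z) = m x y + m x z"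
    and mult_scale_left: "x \<in> A \<Longrightarrow> y \<in> A \<Longrightarrow> m (s c x) y = s c (m x y)"
    and mult_scale_right: "x \<in> A \<Longrightarrow> y \<in> A \<Longrightarrow> m x (s c y) = s c (m x y)"

locale jacobi_jordan_algebra = nonassoc_algebra +
  assumes mult_commute: "x \<in> A \<Longrightarrow> y \<in> A \<Longrightarrow> m x y = m y x"
    and jacobi: "x \<in> A \<Longrightarrow> y \<in> A \<Longrightarrow> z \<in> A \<Longrightarrow>
      m x (m y z) + m y (m z x) + m z (m x y) = 0"

definition associative_on :: "'v set \<Rightarrow> ('v \<Rightarrow> 'v \<Rightarrow> 'v) \<Rightarrow> bool" where
  "associative_on A m \<longleftrightarrow>
     (\<forall>x\<in>A. \<forall>y\<in>A. \<forall>z\<in>A. m (m x y) z = m x (m y z))"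

definition algebra_isomorphic ::
  "('k \<Rightarrow> 'v \<Rightarrow> 'v) \<Rightarrow> 'v::plus set \<Rightarrow> ('v \<Rightarrow> 'v \<Rightarrow> 'v) \<Rightarrow>
   ('k \<Rightarrow> 'w \<Rightarrow> 'w) \<Rightarrow> 'w::plus set \<Rightarrow> ('w \<Rightarrow> 'w \<Rightarrow> 'w) \<Rightarrow> bool" where
  "algebra_isomorphic s A m s' A' m' \<longleftrightarrow>
     (\<exists>f. bij_betw f A A' \<and>
          (\<forall>x\<in>A. \<forall>y\<in>A. f (x + y) = f x + f y) \<and>
          (\<forall>c. \<forall>x\<in>A. f (s c x) = s' c (f x)) \<and>
          (\<forall>x\<in>A. \<forall>y\<in>A. f (m x y) = m' (f x) (f y)))"

definition direct_sum_mult ::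
  "('b \<Rightarrow> 'b \<Rightarrow> 'b) \<Rightarrow> ('c \<Rightarrow> 'c \<Rightarrow> 'c) \<Rightarrow> 'b \<times> 'c \<Rightarrow> 'b \<times> 'c \<Rightarrow> 'b \<times> 'c" where
  "direct_sum_mult mB mC u v = (mB (fst u) (fst v), mC (snd u) (snd v))"

text \<open>
  The direct sum of algebras with carriers \<open>B\<close> and \<open>C\<close> has carrier \<open>B \<times> C\<close>, with componentwise
  operations. HOL cannot quantify over types inside a definition, so the two summands range over
  algebras inside the ambient space of \<open>A\<close>, with arbitrary products. This loses nothing: by lemma
  \<open>decomposable_if_isomorphic_direct_sum\<close> below, summands living in any other types will do.
\<close>

definition decomposable ::
  "('k::field \<Rightarrow> 'v::ab_group_add \<Rightarrow> 'v) \<Rightarrow> 'v set \<Rightarrow> ('v \<Rightarrow> 'v \<Rightarrow> 'v) \<Rightarrow> bool" where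
  "decomposable s A m \<longleftrightarrow>
     (\<exists>B mB C mC.
        nonassoc_algebra s B mB \<and> nonassoc_algebra s C mC \<and> B \<noteq> {0} \<and> C \<noteq> {0} \<and>
        algebra_isomorphic s A m
          (module_prod.scale s s) (B \<times> C) (direct_sum_mult mB mC))"

lemma nonassoc_algebra_transport:
  assumes A: "nonassoc_algebra s A m" and B: "nonassoc_algebra sB B mB"
    and inj: "inj_on h B" and sub: "h ` B \<subseteq> A"
    and add: "\<And>x y. x \<in> B \<Longrightarrow> y \<in> B \<Longrightarrow> h (x + y) = h x + h y"
    and scl: "\<And>c x. x \<in> B \<Longrightarrow> h (sB c x) = s c (h x)"
    and mlt: "\<And>x y. x \<in> B \<Longrightarrow> y \<in> B \<Longrightarrow> h (mB x y) = m (h x) (h y)"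
  shows "nonassoc_algebra s (h ` B) m" and "B \<noteq> {0} \<Longrightarrow> h ` B \<noteq> {0}"
proof -
  interpret A: nonassoc_algebra s A m by (fact A)
  interpret B: nonassoc_algebra sB B mB by (fact B)
  have zB: "0 \<in> B" using B.subspace_carrier by (rule B.subspace_0)
  have h0: "h 0 = 0" using scl[OF zB, of 0] by simp
  have "A.subspace (h ` B)"
  proof (rule A.subspaceI)
    show "0 \<in> h ` B" using zB h0 by (metis imageI)
    show "x + y \<in> h ` B" if "x \<in> h ` B" "y \<in> h ` B" for x y
      using that B.subspace_add[OF B.subspace_carrier] by (auto simp: add[symmetric])
    show "s c x \<in> h ` B" if "x \<in> h ` B" for c x
      using that B.subspace_scale[OF B.subspace_carrier] by (auto simp: scl[symmetric])
  qed
  moreover have "m x y \<in> h ` B" if "x \<in> h ` B" "y \<in> h ` B" for x y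
    using that B.mult_closed by (auto simp: mlt[symmetric])
  ultimately show "nonassoc_algebra s (h ` B) m"
    using sub A.mult_add_left A.mult_add_right A.mult_scale_left A.mult_scale_right
    by unfold_locales (auto simp: subset_iff)
  show "h ` B \<noteq> {0}" if "B \<noteq> {0}"
  proof
    assume "h ` B = {0}"
    then have "h x = h 0" if "x \<in> B" for x
      using that h0 by auto
    then have "x = 0" if "x \<in> B" for x
      using inj_onD[OF inj _ that zB] that by simp
    with zB \<open>B \<noteq> {0}\<close> show False by blast
  qed
qed

lemma decomposable_if_isomorphic_direct_sum:
  fixes s :: "'k::field \<Rightarrow> 'v::ab_group_add \<Rightarrow> 'v"
    and sB :: "'k \<Rightarrow> 'b::ab_group_add \<Rightarrow> 'b" and sC :: "'k \<Rightarrow> 'c::ab_group_add \<Rightarrow> 'c"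
  assumes A: "nonassoc_algebra s A m"
    and B: "nonassoc_algebra sB B mB" and C: "nonassoc_algebra sC C mC"
    and nz: "B \<noteq> {0}" "C \<noteq> {0}"
    and iso: "algebra_isomorphic s A m
      (module_prod.scale sB sC) (B \<times> C) (direct_sum_mult mB mC)"
  shows "decomposable s A m"
proof -
  interpret A: nonassoc_algebra s A m by (fact A)
  interpret B: nonassoc_algebra sB B mB by (fact B)
  interpret C: nonassoc_algebra sC C mC by (fact C)
  interpret BC: module_prod sB sC ..
  interpret AA: module_prod s s ..
  have zB: "0 \<in> B" using B.subspace_carrier by (rule B.subspace_0)
  have zC: "0 \<in> C" using C.subspace_carrier by (rule C.subspace_0)
  have mB0: "mB 0 0 = 0" using B.mult_scale_left[OF zB zB, of 0] by simp
  have mC0: "mC 0 0 = 0" using C.mult_scale_left[OF zC zC, of 0] by simp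
  obtain f where bij: "bij_betw f A (B \<times> C)"
    and fadd: "\<And>x y. x \<in> A \<Longrightarrow> y \<in> A \<Longrightarrow> f (x + y) = f x + f y"
    and fscl: "\<And>c x. x \<in> A \<Longrightarrow> f (s c x) = BC.scale c (f x)"
    and fmlt: "\<And>x y. x \<in> A \<Longrightarrow> y \<in> A \<Longrightarrow> f (m x y) = direct_sum_mult mB mC (f x) (f y)"
    using iso unfolding algebra_isomorphic_def by blast
  define g where "g = inv_into A f"
  have gA: "g u \<in> A" and fg: "f (g u) = u" if "u \<in> B \<times> C" for u
    using that bij unfolding g_def
    by (metis bij_betw_imp_surj_on inv_into_into, metis bij_betw_inv_into_right)
  have gf: "g (f x) = x" if "x \<in> A" for x
    using that bij unfolding g_def by (metis bij_betw_inv_into_left)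
  have fA: "f x \<in> B \<times> C" if "x \<in> A" for x
    using that bij by (rule bij_betw_apply[rotated])
  have eqI: "x = y" if "x \<in> A" "y \<in> A" "f x = f y" for x y
    using that gf by metis
  have gadd: "g (u + v) = g u + g v" if "u \<in> B \<times> C" "v \<in> B \<times> C" for u v
  proof (rule eqI)
    have "u + v \<in> B \<times> C"
      using that B.subspace_add[OF B.subspace_carrier] C.subspace_add[OF C.subspace_carrier]
      by (auto simp: mem_Times_iff)
    then show "g (u + v) \<in> A" "f (g (u + v)) = f (g u + g v)"
      using that by (simp_all add: gA fg fadd)
    show "g u + g v \<in> A"
      using that gA A.subspace_add[OF A.subspace_carrier] by blast
  qed
  have gscl: "g (BC.scale c u) = s c (g u)" if "u \<in> B \<times> C" for c u
  proof (rule eqI)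
    have "BC.scale c u \<in> B \<times> C"
      using that B.subspace_scale[OF B.subspace_carrier] C.subspace_scale[OF C.subspace_carrier]
      by (auto simp: BC.scale_def)
    then show "g (BC.scale c u) \<in> A" "f (g (BC.scale c u)) = f (s c (g u))"
      using that by (simp_all add: gA fg fscl)
    show "s c (g u) \<in> A"
      using that gA A.subspace_scale[OF A.subspace_carrier] by blast
  qed
  have gmlt: "g (direct_sum_mult mB mC u v) = m (g u) (g v)"
    if "u \<in> B \<times> C" "v \<in> B \<times> C" for u v
  proof (rule eqI)
    have "direct_sum_mult mB mC u v \<in> B \<times> C"
      using that B.mult_closed C.mult_closed by (auto simp: direct_sum_mult_def)
    then show "g (direct_sum_mult mB mC u v) \<in> A"
      "f (g (direct_sum_mult mB mC u v)) = f (m (g u) (g v))"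
      using that by (simp_all add: gA fg fmlt)
    show "m (g u) (g v) \<in> A"
      using that gA A.mult_closed by blast
  qed
  define hB where "hB b = g (b, 0)" for b
  define hC where "hC c = g (0, c)" for c
  have hB: "inj_on hB B" "hB ` B \<subseteq> A"
    "\<And>x y. x \<in> B \<Longrightarrow> y \<in> B \<Longrightarrow> hB (x + y) = hB x + hB y"
    "\<And>c x. x \<in> B \<Longrightarrow> hB (sB c x) = s c (hB x)"
    "\<And>x y. x \<in> B \<Longrightarrow> y \<in> B \<Longrightarrow> hB (mB x y) = m (hB x) (hB y)"
    unfolding hB_def
    subgoal using zC fg by (intro inj_onI) (metis SigmaI prod.inject)
    subgoal using zC gA by auto
    subgoal for x y using gadd[of "(x, 0)" "(y, 0)"] zC by simp
    subgoal for c x using gscl[of "(x, 0)" c] zC by (simp add: BC.scale_def)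
    subgoal for x y using gmlt[of "(x, 0)" "(y, 0)"] zC mC0 by (simp add: direct_sum_mult_def)
    done
  have hC: "inj_on hC C" "hC ` C \<subseteq> A"
    "\<And>x y. x \<in> C \<Longrightarrow> y \<in> C \<Longrightarrow> hC (x + y) = hC x + hC y"
    "\<And>c x. x \<in> C \<Longrightarrow> hC (sC c x) = s c (hC x)"
    "\<And>x y. x \<in> C \<Longrightarrow> y \<in> C \<Longrightarrow> hC (mC x y) = m (hC x) (hC y)"
    unfolding hC_def
    subgoal using zB fg by (intro inj_onI) (metis SigmaI prod.inject)
    subgoal using zB gA by auto
    subgoal for x y using gadd[of "(0, x)" "(0, y)"] zB by simp
    subgoal for c x using gscl[of "(0, x)" c] zB by (simp add: BC.scale_def)
    subgoal for x y using gmlt[of "(0, x)" "(0, y)"] zB mB0 by (simp add: direct_sum_mult_def)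
    done
  have nB: "nonassoc_algebra s (hB ` B) m" "hB ` B \<noteq> {0}"
    by (rule nonassoc_algebra_transport[OF A B hB(1,2)], fact+)+
  have nC: "nonassoc_algebra s (hC ` C) m" "hC ` C \<noteq> {0}"
    by (rule nonassoc_algebra_transport[OF A C hC(1,2)], fact+)+
  have bij2: "bij_betw (map_prod hB hC) (B \<times> C) (hB ` B \<times> hC ` C)"
    using hB(1) hC(1) by (auto simp: bij_betw_def map_prod_inj_on map_prod_surj_on)
  have "algebra_isomorphic s A m AA.scale (hB ` B \<times> hC ` C) (direct_sum_mult m m)"
    unfolding algebra_isomorphic_def
  proof (intro exI[of _ "map_prod hB hC \<circ> f"] conjI ballI allI)
    show "bij_betw (map_prod hB hC \<circ> f) A (hB ` B \<times> hC ` C)"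
      using bij bij2 by (rule bij_betw_trans)
    fix x assume x: "x \<in> A"
    obtain b c where fx: "f x = (b, c)" and bc: "b \<in> B" "c \<in> C" using fA[OF x] by auto
    show "(map_prod hB hC \<circ> f) (s k x) = AA.scale k ((map_prod hB hC \<circ> f) x)" for k
      using x fx bc by (simp add: fscl BC.scale_def AA.scale_def hB(4) hC(4))
    fix y assume y: "y \<in> A"
    obtain b' c' where fy: "f y = (b', c')" and bc': "b' \<in> B" "c' \<in> C" using fA[OF y] by auto
    show "(map_prod hB hC \<circ> f) (x + y) = (map_prod hB hC \<circ> f) x + (map_prod hB hC \<circ> f) y"
      using x y fx bc fy bc' by (simp add: fadd hB(3) hC(3))
    show "(map_prod hB hC \<circ> f) (m x y) =
        direct_sum_mult m m ((map_prod hB hC \<circ> f) x) ((map_prod hB hC \<circ> f) y)"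
      using x y fx bc fy bc' by (simp add: fmlt direct_sum_mult_def hB(5) hC(5))
  qed
  then show ?thesis
    unfolding decomposable_def using nB nC by (intro exI conjI)
qed

text \<open>
  The algebra on \<open>K\<^sup>5\<close> with basis \<open>e\<^sub>i = axis i 1\<close>, where a triple \<open>(i, j, k) \<in> P\<close> stands for the listed
  product \<open>e\<^sub>i \<cdot> e\<^sub>j = e\<^sub>k\<close> and all products not listed are zero. The indices are \<open>1, \<dots>, 5\<close>, read in the
  five-element numeral type \<open>5\<close> (in which \<open>5\<close> is another name for \<open>0\<close>).
\<close>

definition table_mult :: "(5 \<times> 5 \<times> 5) set \<Rightarrow> ('k::field)^5 \<Rightarrow> 'k^5 \<Rightarrow> 'k^5" where
  "table_mult P x y = (\<Sum>(i, j, k)\<in>P. axis k (x $ i * y $ j))"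

datatype listed_algebra =
    A01_pow5          (* A_{0,1}^5 *)
  | A12_A01_pow3      (* A_{1,2} (+) A_{0,1}^3 *)
  | A13_A01_pow2      (* A_{1,3} (+) A_{0,1}^2 *)
  | A24_A01           (* A_{2,4} (+) A_{0,1} *)
  | A12_pow2_A01      (* A_{1,2}^2 (+) A_{0,1} *)
  | A12_A13           (* A_{1,2} (+) A_{1,3} *)
  | A14_A01           (* A_{1,4} (+) A_{0,1} *)

primrec products :: "listed_algebra \<Rightarrow> (5 \<times> 5 \<times> 5) set" where
  "products A01_pow5 = {}"
| "products A12_A01_pow3 = {(1, 1, 2)}"
| "products A13_A01_pow2 = {(1, 1, 2), (3, 3, 2)}"
| "products A24_A01 = {(1, 1, 2), (3, 4, 2), (4, 3, 2)}"
| "products A12_pow2_A01 = {(1, 1, 2), (3, 3, 4)}"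
| "products A12_A13 = {(1, 1, 2), (3, 3, 4), (5, 5, 4)}"
| "products A14_A01 = {(1, 1, 2), (1, 3, 4), (3, 1, 4)}"

end

theory Submission
  imports Defs
begin

text \<open>
  A commutative associative algebra satisfying the Jacobi identity has \<open>3 x (y z) = 0\<close>, because all
  three Jacobi summands are the same product; as \<open>3\<close> is invertible, all products of three elements
  vanish. Conversely, a commutative algebra with this property is just a symmetric bilinear map on
  \<open>A\<close> with values in the annihilator, so the classification is one of small systems of quadratic
  forms. Write \<open>A = B + C\<close> with ideals \<open>B\<close>, \<open>C\<close> that annihilate each other.

  If both ideals have nonzero products, polarisation gives \<open>b \<in> B\<close> and \<open>c \<in> C\<close> with nonzero squares.
  The vectors \<open>b, b b, c, c c\<close> are independent, and one more basis vector can be chosen in one of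
  the two ideals, say in \<open>C\<close>. Nilpotency forces its products with \<open>c\<close> and with itself into the line
  of \<open>c c\<close>, and completing the square turns it into a vector orthogonal to \<open>c\<close> whose square is zero
  or \<open>c c\<close> (lemma \<open>classification_both_nontrivial\<close>).

  Otherwise one ideal, say \<open>B\<close>, has zero product. It then consists of annihilating vectors, and all
  products lie in \<open>C\<close>. If all products lie in one line, there is a single quadratic form; it is
  diagonalised, and its radical is at least two-dimensional because it contains both the line and a
  vector of \<open>B\<close>, so its rank is at most 3 (lemma \<open>classification_products_in_line\<close>). If the products
  span more than a line, a dimension count shows that two vectors \<open>x, y\<close> generate \<open>A\<close> modulo the
  annihilator and that \<open>x x, x y, y y\<close> are linearly dependent. A binary quadratic form over an
  algebraically closed field is a product of linear forms, so this dependence says that some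
  product \<open>u v\<close> of nonzero combinations of \<open>x\<close> and \<open>y\<close> vanishes. The two possible algebras
  correspond to independent and proportional \<open>u, v\<close> (lemma \<open>classification_products_not_in_line\<close>).

  Throughout, a vector \<open>x\<close> is shown to lie outside the span of \<open>S\<close> by exhibiting \<open>c\<close> such that
  multiplication by \<open>c\<close> kills \<open>S\<close> but not \<open>x\<close> (lemma \<open>not_in_span_if_killed\<close>).

  The seven tables are told apart by the dimension of the annihilator, by whether all products lie
  in a line, and by whether some vector outside the annihilator has square zero.
\<close>

lemma exhaust_5: "x = 1 \<or> x = 2 \<or> x = 3 \<or> x = 4 \<or> x = 5" for x :: 5
proof (induct x)
  case (of_int z)
  then have "0 \<le> z" and "z < 5" by simp_all
  then have "z = 0 \<or> z = 1 \<or> z = 2 \<or> z = 3 \<or> z = 4" by arith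
  then show ?case by auto
qed

lemma UNIV_5: "(UNIV :: 5 set) = {1, 2, 3, 4, 5}"
  using exhaust_5 by auto

lemma forall_5: "(\<forall>i::5. P i) \<longleftrightarrow> P 1 \<and> P 2 \<and> P 3 \<and> P 4 \<and> P 5"
  by (metis exhaust_5)

section \<open>Commutative algebras with vanishing triple products\<close>

locale cube_zero_algebra_5 = nonassoc_algebra s A m
  for s :: "'k::alg_closed_field \<Rightarrow> 'v::ab_group_add \<Rightarrow> 'v" and A m +
  assumes mult_commute: "x \<in> A \<Longrightarrow> y \<in> A \<Longrightarrow> m x y = m y x"
    and mult_mult: "x \<in> A \<Longrightarrow> y \<in> A \<Longrightarrow> z \<in> A \<Longrightarrow> m x (m y z) = 0"
    and two_nonzero: "(2::'k) \<noteq> 0"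
    and dim_carrier: "dim A = 5"
begin

lemmas carrier_0 = subspace_0[OF subspace_carrier]
lemmas carrier_add = subspace_add[OF subspace_carrier]
lemmas carrier_diff = subspace_diff[OF subspace_carrier]
lemmas carrier_scale = subspace_scale[OF subspace_carrier]
lemmas carrier_intros = carrier_0 carrier_add carrier_diff carrier_scale mult_closed

lemma mult_zero_left: "y \<in> A \<Longrightarrow> m 0 y = 0"
  using mult_scale_left[of 0 y 0] carrier_0 by simp

lemma mult_zero_right: "y \<in> A \<Longrightarrow> m y 0 = 0"
  using mult_scale_right[of y 0 0] carrier_0 by simp

lemma mult_diff_left:
  assumes "x \<in> A" "y \<in> A" "z \<in> A" shows "m (x - y) z = m x z - m y z"
  using mult_add_left[of "x - y" y z] assms carrier_diff by (simp add: algebra_simps)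

lemma mult_diff_right:
  assumes "x \<in> A" "y \<in> A" "z \<in> A" shows "m z (x - y) = m z x - m z y"
  using mult_diff_left[OF assms] assms by (simp add: mult_commute carrier_diff)

lemma mult_mult_left: "x \<in> A \<Longrightarrow> y \<in> A \<Longrightarrow> z \<in> A \<Longrightarrow> m (m x y) z = 0"
  using mult_mult[of z x y] mult_commute[of "m x y" z] by (simp add: mult_closed)

lemmas bilinear = mult_add_left mult_add_right mult_diff_left mult_diff_right mult_scale_left
  mult_scale_right mult_zero_left mult_zero_right mult_mult mult_mult_left

lemma carrier_sum: "(\<And>i. i \<in> I \<Longrightarrow> x i \<in> A) \<Longrightarrow> sum x I \<in> A"
  by (rule subspace_sum[OF subspace_carrier])

lemma mult_sum_left:
  assumes "\<And>i. i \<in> I \<Longrightarrow> x i \<in> A" "y \<in> A" shows "m (sum x I) y = (\<Sum>i\<in>I. m (x i) y)"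
  using assms
  by (induction I rule: infinite_finite_induct) (auto simp: mult_add_left mult_zero_left carrier_sum)

lemma mult_sum_right:
  assumes "\<And>i. i \<in> I \<Longrightarrow> x i \<in> A" "y \<in> A" shows "m y (sum x I) = (\<Sum>i\<in>I. m y (x i))"
  using assms
  by (induction I rule: infinite_finite_induct) (auto simp: mult_add_right mult_zero_right carrier_sum)

lemma span_carrier: "S \<subseteq> A \<Longrightarrow> span S \<subseteq> A"
  by (rule span_minimal[OF _ subspace_carrier])

definition Ann :: "'v set" where "Ann = {x \<in> A. \<forall>y\<in>A. m x y = 0}"

lemma Ann_mult:
  assumes "x \<in> Ann" "y \<in> A" shows "m x y = 0" "m y x = 0"
  using assms mult_commute[of x y] by (auto simp: Ann_def)

lemma Ann_carrier: "x \<in> Ann \<Longrightarrow> x \<in> A"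
  by (simp add: Ann_def)

lemma mult_in_Ann: "x \<in> A \<Longrightarrow> y \<in> A \<Longrightarrow> m x y \<in> Ann"
  by (simp add: Ann_def mult_closed mult_mult_left)

text \<open>
  Multiplication by \<open>c\<close> is linear, so its kernel is a subspace. Almost every independence proof
  below applies this lemma once per basis vector.
\<close>

lemma not_in_span_if_killed:
  assumes c: "c \<in> A" and S: "S \<subseteq> A" "\<And>y. y \<in> S \<Longrightarrow> m y c = 0" and x: "m x c \<noteq> 0"
  shows "x \<notin> span S"
proof
  assume "x \<in> span S"
  moreover have "span S \<subseteq> {y \<in> A. m y c = 0}"
    using c S by (intro span_minimal subspaceI) (auto simp: bilinear carrier_intros)
  ultimately show False using x by auto
qed

lemma independent_insert_card:
  assumes "independent S" "finite S" "x \<notin> span S"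
  shows "independent (insert x S)" "finite (insert x S)" "card (insert x S) = Suc (card S)"
proof -
  have "x \<notin> S" using assms(3) span_base by blast
  then show "finite (insert x S)" "card (insert x S) = Suc (card S)" using assms(2) by simp_all
  show "independent (insert x S)" using assms by (simp add: independent_insertI)
qed

lemma independent_5:
  assumes "x1 \<noteq> 0" "x2 \<notin> span {x1}" "x3 \<notin> span {x2, x1}" "x4 \<notin> span {x3, x2, x1}"
    "x5 \<notin> span {x4, x3, x2, x1}"
  shows "independent {x5, x4, x3, x2, x1}" "card {x5, x4, x3, x2, x1} = 5"
proof -
  have 1: "independent {x1}" "finite {x1}" using assms(1) by simp_all
  note 2 = independent_insert_card[OF 1 assms(2)]
  note 3 = independent_insert_card[OF 2(1,2) assms(3)]
  note 4 = independent_insert_card[OF 3(1,2) assms(4)]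
  note 5 = independent_insert_card[OF 4(1,2) assms(5)]
  show "independent {x5, x4, x3, x2, x1}" by (fact 5)
  show "card {x5, x4, x3, x2, x1} = 5" unfolding 5(3) 4(3) 3(3) 2(3) by simp
qed

lemma finite_basis_carrier:
  obtains T where "finite T" "T \<subseteq> A" "independent T" "span T = A" "card T = 5"
proof -
  obtain T where "T \<subseteq> A" "independent T" "A \<subseteq> span T" "card T = dim A"
    by (rule basis_exists)
  moreover from this have "finite T" using dim_carrier by (metis card.infinite zero_neq_numeral)
  ultimately show thesis using that[of T] span_carrier[of T] dim_carrier by auto
qed

lemma independent_finite:
  assumes "independent S" "S \<subseteq> A" shows "finite S" "card S \<le> 5"
  using assms by (metis finite_basis_carrier independent_span_bound)+

text \<open>
  The ambient space may be infinite-dimensional, so the basis extension has to be done inside the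
  carrier. Choosing the new vectors from a given spanning set \<open>V\<close> keeps control over their products.
\<close>

lemma extend_to_basis:
  assumes "independent S" "S \<subseteq> V" "V \<subseteq> A" "span V = A"
  obtains T where "S \<subseteq> T" "T \<subseteq> V" "independent T" "span T = A" "card T = 5" "finite T"
proof -
  obtain T where T: "S \<subseteq> T" "T \<subseteq> V" "independent T" "V \<subseteq> span T"
    using maximal_independent_subset_extend[OF assms(2,1)] by blast
  have "A \<subseteq> span T" using T(4) assms(4) by (metis span_mono span_span)
  moreover have "T \<subseteq> A" using T(2) assms(3) by blast
  ultimately have "span T = A" "card T = 5"
    using span_carrier basis_card_eq_dim T(3) dim_carrier by auto
  with T that show thesis using independent_finite[OF T(3) \<open>T \<subseteq> A\<close>] by blast
qed

lemma span_eq_carrier: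
  assumes "independent S" "S \<subseteq> A" "card S = 5" shows "span S = A"
proof -
  obtain T where "S \<subseteq> T" "T \<subseteq> A" "independent T" "span T = A" "card T = 5" "finite T"
    by (rule extend_to_basis[OF assms(1,2)]) (simp_all add: span_eq_iff subspace_carrier)
  then show ?thesis using assms(3) by (metis card_subset_eq)
qed

text \<open>
  The linear map sending \<open>axis i 1\<close> to \<open>e i\<close> is onto \<open>A\<close> because five independent vectors span a
  space of dimension five; its inverse is the required isomorphism. By bilinearity it is enough to
  compare products of basis vectors.
\<close>

lemma isomorphic_table:
  fixes e :: "5 \<Rightarrow> 'v"
  assumes e: "\<And>i. e i \<in> A" "inj e" "independent (range e)"
    and prod: "\<And>i j. m (e i) (e j) = (\<Sum>(a, b, c)\<in>P. if i = a \<and> j = b then e c else 0)"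
  shows "algebra_isomorphic s A m (*s) (UNIV :: ('k^5) set) (table_mult P)"
proof -
  define g where "g x = (\<Sum>i\<in>UNIV. s (x $ i) (e i))" for x :: "'k^5"
  have g_add: "g (x + y) = g x + g y" for x y
    by (simp add: g_def scale_left_distrib sum.distrib)
  have g_scale: "g (c *s x) = s c (g x)" for c x
    by (simp add: g_def scale_sum_right)
  have g_axis: "g (axis i c) = s c (e i)" for i c
    by (simp add: g_def axis_def if_distrib[of "\<lambda>c. s c _"] cong: if_cong)
  have g_0: "g 0 = 0" by (simp add: g_def)
  have g_sum: "g (sum x I) = (\<Sum>i\<in>I. g (x i))" if "finite I" for x :: "_ \<Rightarrow> 'k^5" and I :: "(5 \<times> 5 \<times> 5) set"
    using that by (induction I rule: finite_induct) (auto simp: g_add g_0)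
  have g_carrier: "g x \<in> A" for x
    unfolding g_def by (intro carrier_sum carrier_scale e)
  have g_mult: "g (table_mult P x y) = m (g x) (g y)" for x y
  proof -
    have "m (g x) (g y) = (\<Sum>i\<in>UNIV. \<Sum>j\<in>UNIV. s (x $ i * y $ j) (m (e i) (e j)))"
      unfolding g_def
      by (simp add: mult_sum_left mult_sum_right carrier_sum carrier_scale e mult_scale_left
          mult_scale_right scale_sum_right)
         (subst sum.swap, simp add: mult.commute)
    also have "\<dots> = (\<Sum>i\<in>UNIV. \<Sum>j\<in>UNIV. \<Sum>(a, b, c)\<in>P.
        if i = a \<and> j = b then s (x $ i * y $ j) (e c) else 0)"
      unfolding prod scale_sum_right by (intro sum.cong refl) (auto split: prod.splits)
    also have "\<dots> = (\<Sum>(a, b, c)\<in>P. \<Sum>i\<in>UNIV. \<Sum>j\<in>UNIV.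
        if i = a \<and> j = b then s (x $ i * y $ j) (e c) else 0)"
      unfolding sum.swap[where B = P] split_def ..
    also have "\<dots> = (\<Sum>(a, b, c)\<in>P. s (x $ a * y $ b) (e c))"
    proof (intro sum.cong refl, clarify)
      fix a b c
      have "(\<Sum>j\<in>UNIV. if i = a \<and> j = b then s (x $ i * y $ j) (e c) else 0) =
          (if i = a then s (x $ i * y $ b) (e c) else 0)" for i
        by simp
      then show "(\<Sum>i\<in>UNIV. \<Sum>j\<in>UNIV. if i = a \<and> j = b then s (x $ i * y $ j) (e c) else 0) =
        s (x $ a * y $ b) (e c)" by simp
    qed
    also have "\<dots> = g (table_mult P x y)"
      unfolding table_mult_def by (subst g_sum) (auto simp: g_axis split_def)
    finally show ?thesis ..
  qed
  have "inj g"
  proof (rule injI)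
    fix x y assume "g x = g y"
    then have 0: "(\<Sum>i\<in>UNIV. s ((x - y) $ i) (e i)) = 0"
      by (simp add: g_def scale_left_diff_distrib sum_subtractf)
    have "(\<Sum>v\<in>range e. s ((x - y) $ inv e v) v) = 0"
      using 0 e(2) by (simp add: sum.reindex)
    then have "(x - y) $ inv e (e i) = 0" for i
      using independentD[OF e(3), of "range e" "\<lambda>v. (x - y) $ inv e v" "e i"] by simp
    then show "x = y" using e(2) by (simp add: vec_eq_iff)
  qed
  moreover have "range g = A"
  proof
    show "range g \<subseteq> A" using g_carrier by auto
    have "card (range e) = 5" using e(2) by (simp add: card_image)
    then have "A = span (range e)" using span_eq_carrier e by auto
    also have "\<dots> \<subseteq> range g"
    proof (rule span_minimal)
      show "range e \<subseteq> range g" using g_axis[of _ 1] by (auto simp: image_iff) metis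
      show "subspace (range g)"
      proof (rule subspaceI)
        show "0 \<in> range g" using g_0 by (metis rangeI)
      qed (auto simp: g_add[symmetric] g_scale[symmetric])
    qed
    finally show "A \<subseteq> range g" .
  qed
  ultimately have bij: "bij_betw g UNIV A" by (simp add: bij_betw_def)
  have gi: "g (inv g x) = x" if "x \<in> A" for x
    using that \<open>range g = A\<close> by (auto simp: f_inv_into_f)
  have eqI: "u = v" if "g u = g v" for u v
    using that \<open>inj g\<close> by (simp add: inj_def)
  show ?thesis
    unfolding algebra_isomorphic_def
    by (intro exI[of _ "inv g"] conjI ballI allI bij_betw_inv_into[OF bij] eqI)
       (simp_all add: gi g_add g_scale g_mult carrier_intros)
qed

lemma isomorphic_table_explicit:
  assumes ind: "independent {a, b, c, d, f}" "card {a, b, c, d, f} = 5" "{a, b, c, d, f} \<subseteq> A"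
    and e: "e = (\<lambda>i::5. if i = 1 then a else if i = 2 then b else if i = 3 then c
      else if i = 4 then d else f)"
    and prod: "\<forall>i j. m (e i) (e j) = (\<Sum>(a, b, c)\<in>P. if i = a \<and> j = b then e c else 0)"
  shows "algebra_isomorphic s A m (*s) (UNIV :: ('k^5) set) (table_mult P)"
proof (rule isomorphic_table[OF _ _ _ prod[rule_format]])
  have r: "range e = {a, b, c, d, f}" unfolding UNIV_5 e by auto
  show "e i \<in> A" for i using ind(3) r by (metis rangeI subsetD)
  show "inj e" using ind(2) r by (intro eq_card_imp_inj_on) auto
  show "independent (range e)" using ind(1) r by simp
qed


lemma subspace_Ann: "subspace Ann"
  by (intro subspaceI) (auto simp: Ann_def bilinear carrier_intros)

lemma scale_solve:
  assumes "s a x + s b y = 0" "a \<noteq> 0" shows "x = s (- b / a) y"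
proof -
  have "s a x = s (- b) y" using assms(1) by (simp add: eq_neg_iff_add_eq_0)
  then have "s (1 / a) (s a x) = s (1 / a) (s (- b) y)" by simp
  then show ?thesis using assms(2) by simp
qed

text \<open>Polarisation: \<open>(x + y) (x + y) = 2 x y\<close> if all squares vanish.\<close>

lemma mult_zero_if_squares_zero:
  assumes U: "subspace U" "U \<subseteq> A" and sq: "\<And>x. x \<in> U \<Longrightarrow> m x x = 0"
    and xy: "x \<in> U" "y \<in> U"
  shows "m x y = 0"
proof -
  have A: "x \<in> A" "y \<in> A" using xy U by auto
  have "m (x + y) (x + y) = 0" using sq U xy subspace_add by blast
  then have "m x y + m x y = 0"
    using A sq xy by (simp add: bilinear carrier_intros mult_commute[of y x])
  then have "s (1 + 1) (m x y) = 0" by (simp only: scale_left_distrib scale_one)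
  then show ?thesis using two_nonzero by simp
qed

lemma modulo_Ann:
  assumes "A = span (insert u (insert v S))" "S \<subseteq> Ann" "a \<in> A"
  obtains j k n where "a = s j u + s k v + n" "n \<in> Ann"
proof -
  obtain j k where "a - s j u - s k v \<in> span S"
    using assms(1,3) by (auto simp: span_breakdown_eq)
  then have "a - s j u - s k v \<in> Ann" using span_minimal[OF assms(2) subspace_Ann] by blast
  then show thesis using that[of j k "a - s j u - s k v"] by simp
qed

lemma products_from_two_generators:
  assumes "A = span (insert u (insert v S))" "S \<subseteq> Ann" "u \<in> A" "v \<in> A" "x \<in> A" "y \<in> A"
  obtains i j k where "m x y = s i (m u u) + s j (m u v) + s k (m v v)"
proof -
  obtain a b n where x: "x = s a u + s b v + n" "n \<in> Ann"
    by (rule modulo_Ann[OF assms(1,2,5)])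
  obtain a' b' n' where y: "y = s a' u + s b' v + n'" "n' \<in> Ann"
    by (rule modulo_Ann[OF assms(1,2,6)])
  have "m x y = s (a * a') (m u u) + s (a * b' + b * a') (m u v) + s (b * b') (m v v)"
    using x y assms(3,4) Ann_carrier[OF x(2)] Ann_carrier[OF y(2)]
    by (simp add: bilinear carrier_intros Ann_mult mult_commute[of v u] scale_left_distrib
        scale_right_distrib algebra_simps)
  with that show thesis .
qed

section \<open>Products in a single line\<close>

lemma in_Ann_if_kills_spanning_set:
  assumes "u \<in> A" "S \<subseteq> A" "span S = A" and "\<And>y. y \<in> S \<Longrightarrow> m u y = 0" shows "u \<in> Ann"
proof -
  have "span S \<subseteq> {y \<in> A. m u y = 0}"
    using assms(1,2,4)
    by (intro span_minimal subspaceI) (auto simp: bilinear carrier_intros)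
  then show ?thesis using assms(1,3) by (auto simp: Ann_def)
qed

text \<open>
  If all products lie in the line of \<open>z\<close>, the coefficient of \<open>z\<close> is a symmetric bilinear form, and
  \<open>diagonal_on z E\<close> says that \<open>E\<close> is orthonormal for it.
\<close>

definition diagonal_on :: "'v \<Rightarrow> 'v set \<Rightarrow> bool" where
  "diagonal_on z E \<longleftrightarrow> E \<subseteq> A \<and> (\<forall>x\<in>E. \<forall>y\<in>E. m x y = (if x = y then z else 0))"

text \<open>
  An element of \<open>E\<close> kills \<open>z\<close>, \<open>b\<close> and the other elements of \<open>E\<close>, but not itself. In particular
  orthonormal sets have at most three elements.
\<close>

lemma independent_diagonal:
  assumes E: "diagonal_on z E" and zb: "z \<in> Ann" "b \<in> Ann" "z \<noteq> 0" "b \<notin> span {z}"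
  shows "independent (E \<union> {z, b})" "finite E" "card (E \<union> {z, b}) = card E + 2"
proof -
  have base: "independent {z, b}" "card {z, b} = 2"
    using independent_insert_card[of "{z}" b] zb by (simp_all add: insert_commute)
  have EA: "E \<subseteq> A" using E by (simp add: diagonal_on_def)
  have *: "finite F \<Longrightarrow> F \<subseteq> E \<Longrightarrow> independent (F \<union> {z, b}) \<and> card (F \<union> {z, b}) = card F + 2" for F
  proof (induction F rule: finite_induct)
    case empty
    then show ?case using base by simp
  next
    case (insert x F)
    have "x \<notin> span (F \<union> {z, b})"
      by (rule not_in_span_if_killed[of x])
         (use insert E EA zb in \<open>auto simp: diagonal_on_def Ann_mult Ann_carrier subset_iff\<close>)
    moreover have "insert x F \<union> {z, b} = insert x (F \<union> {z, b})" by auto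
    ultimately show ?case
      using independent_insert_card[of "F \<union> {z, b}" x] insert by (simp del: Un_insert_right)
  qed
  show "finite E"
  proof (rule ccontr)
    assume "infinite E"
    then obtain F where F: "F \<subseteq> E" "finite F" "card F = 6"
      by (metis infinite_arbitrarily_large)
    have "card (F \<union> {z, b}) \<le> 5"
      using * F EA zb Ann_carrier by (intro independent_finite) auto
    then show False using * F by auto
  qed
  then show "independent (E \<union> {z, b})" "card (E \<union> {z, b}) = card E + 2" using * by auto
qed

text \<open>
  Orthogonal projection: subtracting from \<open>a\<close> its components along \<open>E\<close> leaves a vector orthogonal to
  \<open>E\<close>.
\<close>

lemma carrier_eq_diagonal_plus_orthogonal:
  assumes E: "diagonal_on z E" "finite E" and line: "\<And>x y. x \<in> A \<Longrightarrow> y \<in> A \<Longrightarrow> \<exists>k. m x y = s k z"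
  shows "span (E \<union> {u \<in> A. \<forall>e\<in>E. m u e = 0}) = A" (is "span (E \<union> ?W) = A")
proof
  have EA: "E \<subseteq> A" using E by (simp add: diagonal_on_def)
  then show "span (E \<union> ?W) \<subseteq> A" by (intro span_carrier) auto
  show "A \<subseteq> span (E \<union> ?W)"
  proof
    fix a assume a: "a \<in> A"
    obtain k where k: "\<And>e. e \<in> E \<Longrightarrow> m a e = s (k e) z"
      using line[OF a] EA by (metis subsetD)
    define p where "p = (\<Sum>e\<in>E. s (k e) e)"
    have p: "p \<in> A" "p \<in> span (E \<union> ?W)"
      unfolding p_def using EA
      by (intro carrier_sum carrier_scale, blast) (intro span_sum span_scale span_base, blast)
    have "m p e = m a e" if e: "e \<in> E" for e
    proof -
      have "m p e = (\<Sum>e'\<in>E. s (k e') (m e' e))"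
        using EA e by (auto simp: p_def mult_sum_left carrier_scale mult_scale_left subset_iff
            intro!: sum.cong)
      also have "\<dots> = (\<Sum>e'\<in>E. if e' = e then s (k e') z else 0)"
        using E e by (intro sum.cong) (auto simp: diagonal_on_def)
      finally show ?thesis using e E(2) k by simp
    qed
    then have "a - p \<in> ?W" using a p EA by (auto simp: bilinear carrier_intros subset_iff)
    then have "a - p \<in> span (E \<union> ?W)" by (intro span_base) auto
    then show "a \<in> span (E \<union> ?W)" using p span_add by fastforce
  qed
qed

text \<open>
  Take \<open>E\<close> orthonormal of maximal cardinality. A vector orthogonal to \<open>E\<close> with nonzero square could be
  rescaled and added to \<open>E\<close>, square roots being available; hence the orthogonal complement has zero
  squares, by polarisation zero products, and therefore is annihilated by everything. Two
  annihilating vectors \<open>z\<close>, \<open>b\<close> can be kept in the resulting basis, which bounds the rank by 3.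
\<close>

lemma diagonalisation:
  assumes zb: "z \<in> Ann" "b \<in> Ann" "z \<noteq> 0" "b \<notin> span {z}"
    and line: "\<And>x y. x \<in> A \<Longrightarrow> y \<in> A \<Longrightarrow> \<exists>k. m x y = s k z"
  obtains E F where "diagonal_on z E" "F \<subseteq> Ann" "independent (E \<union> F)" "{z, b} \<subseteq> F"
    "card E + card F = 5" "E \<inter> F = {}" "finite E" "finite F"
proof -
  have small: "card E < 6" if "diagonal_on z E" for E
  proof -
    have "card (E \<union> {z, b}) \<le> 5"
      using independent_diagonal[OF that zb] that zb Ann_carrier
      by (intro independent_finite) (auto simp: diagonal_on_def)
    then show ?thesis using independent_diagonal[OF that zb] by simp
  qed
  have "diagonal_on z {}" by (simp add: diagonal_on_def)
  then obtain E where E: "diagonal_on z E"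
    and max: "\<And>E'. diagonal_on z E' \<Longrightarrow> card E' \<le> card E"
    using ex_has_greatest_nat[of "diagonal_on z" "{}" card 6] small by blast
  note ind = independent_diagonal[OF E zb]
  have EA: "E \<subseteq> A" using E by (simp add: diagonal_on_def)
  define W where "W = {u \<in> A. \<forall>e\<in>E. m u e = 0}"
  have W: "W \<subseteq> A" "subspace W"
    unfolding W_def using EA
    by (auto intro!: subspaceI simp: bilinear carrier_intros subset_iff)
  have spanA: "span (E \<union> W) = A"
    unfolding W_def by (rule carrier_eq_diagonal_plus_orthogonal[OF E ind(2) line])
  have sq: "m u u = 0" if u: "u \<in> W" for u
  proof (rule ccontr)
    assume "m u u \<noteq> 0"
    moreover obtain k where k: "m u u = s k z" using line u W by blast
    ultimately have "k \<noteq> 0" by auto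
    then obtain r where r: "r ^ 2 = k" "r \<noteq> 0" using nth_root_exists[of 2 k] by fastforce
    define v where "v = s (1 / r) u"
    have v: "v \<in> W" "v \<in> A" using u W by (auto simp: v_def subspace_scale)
    have vv: "m v v = z"
      using u W r k by (auto simp: v_def bilinear carrier_intros power2_eq_square subset_iff)
    have vE: "m v x = 0" "m x v = 0" if "x \<in> E" for x
      using that v EA mult_commute[of x v] by (auto simp: W_def)
    have "v \<notin> E" using v vv zb(3) by (auto simp: W_def)
    moreover have "diagonal_on z (insert v E)"
      using E v vv \<open>v \<notin> E\<close> vE by (auto simp: diagonal_on_def)
    ultimately show False using max[of "insert v E"] ind(2) by simp
  qed
  have WW: "m u v = 0" if "u \<in> W" "v \<in> W" for u v
    by (rule mult_zero_if_squares_zero[OF W(2,1) sq that])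
  have WAnn: "W \<subseteq> Ann"
  proof
    fix u assume u: "u \<in> W"
    show "u \<in> Ann"
    proof (rule in_Ann_if_kills_spanning_set[OF _ _ spanA])
      show "m u y = 0" if "y \<in> E \<union> W" for y
      proof (cases "y \<in> E")
        case True
        then show ?thesis using u by (simp add: W_def)
      next
        case False
        then show ?thesis using that u WW by blast
      qed
    qed (use u W EA in auto)
  qed
  have "{z, b} \<subseteq> W" using zb EA by (auto simp: W_def Ann_carrier Ann_mult subset_iff)
  then have sub: "E \<union> {z, b} \<subseteq> E \<union> W" "E \<union> W \<subseteq> A" using EA W by auto
  obtain T where T: "E \<union> {z, b} \<subseteq> T" "T \<subseteq> E \<union> W" "independent T" "card T = 5" "finite T"
    by (rule extend_to_basis[OF ind(1) sub spanA])
  have "m x x = z" if "x \<in> E" for x using E that by (auto simp: diagonal_on_def)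
  then have "z \<notin> E" "b \<notin> E" using zb Ann_carrier Ann_mult(1) by metis+
  moreover have "card E \<le> 5" using T card_mono[of T E] by simp
  ultimately show thesis
    using T WAnn ind(2)
    by (intro that[of E "T - E"] E) (auto simp: Un_absorb1 card_Diff_subset)
qed

text \<open>
  The rank of the form, which is the cardinality of \<open>E\<close>, determines the algebra. In rank 3 the
  table for \<open>A\<^sub>2\<^sub>,\<^sub>4\<close> uses one unit vector and a hyperbolic pair.
\<close>

lemma classification_products_in_line:
  assumes zb: "z \<in> Ann" "b \<in> Ann" "z \<noteq> 0" "b \<notin> span {z}"
    and line: "\<And>x y. x \<in> A \<Longrightarrow> y \<in> A \<Longrightarrow> \<exists>k. m x y = s k z"
  shows "\<exists>N. algebra_isomorphic s A m (*s) (UNIV :: ('k^5) set) (table_mult (products N))"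
proof -
  obtain E F where E: "diagonal_on z E" and F: "F \<subseteq> Ann" and ind: "independent (E \<union> F)"
    and zbF: "{z, b} \<subseteq> F" and card: "card E + card F = 5" and dis: "E \<inter> F = {}"
    and fin: "finite E" "finite F"
    by (rule diagonalisation[OF zb line])
  define G where "G = F - {z, b}"
  have "z \<noteq> b" using zb(4) span_base by blast
  then have G: "F = insert z (insert b G)" "card E + card G = 3" "finite G"
    using zbF card fin card_Diff_subset[of "{z, b}" F] card_mono[of F "{z, b}"] by (auto simp: G_def)
  have GAnn: "x \<in> Ann" if "x \<in> G" for x using that F G(1) by auto
  have EA: "E \<subseteq> A" using E by (simp add: diagonal_on_def)
  have cardEF: "card (E \<union> F) = 5" using card dis fin by (simp add: card_Un_disjoint)
  note simps = forall_5 bilinear Ann_mult Ann_carrier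
  have "card E \<le> 3" using G by simp
  then consider "card E = 0" | "card E = 1" | "card E = 2" | "card E = 3" by linarith
  then show ?thesis
  proof cases
    case 1
    then have "E = {}" "card G = 3" using fin G by auto
    then obtain g h i where GG: "G = {g, h, i}" by (auto simp: card_3_iff)
    then have *: "E \<union> F = {z, b, g, h, i}" using G \<open>E = {}\<close> by auto
    have Ann: "g \<in> Ann" "h \<in> Ann" "i \<in> Ann" using GAnn GG by auto
    show ?thesis
      by (intro exI[of _ A01_pow5], rule isomorphic_table_explicit[OF _ _ _ refl, of z b g h i])
         (use * ind cardEF zb Ann in \<open>auto simp: simps\<close>)
  next
    case 2
    then obtain e where EE: "E = {e}" by (auto simp: card_1_singleton_iff)
    have "card G = 2" using 2 G by simp
    then obtain g h where GG: "G = {g, h}" by (auto simp: card_2_iff)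
    then have *: "E \<union> F = {e, z, b, g, h}" using G EE by auto
    have Ann: "g \<in> Ann" "h \<in> Ann" using GAnn GG by auto
    have e: "e \<in> A" "m e e = z" using E EE by (auto simp: diagonal_on_def)
    show ?thesis
      by (intro exI[of _ A12_A01_pow3], rule isomorphic_table_explicit[OF _ _ _ refl, of e z b g h])
         (use * ind cardEF zb Ann e in \<open>auto simp: simps\<close>)
  next
    case 3
    then obtain e f where EE: "E = {e, f}" "e \<noteq> f" by (auto simp: card_2_iff)
    have "card G = 1" using 3 G by simp
    then obtain g where GG: "G = {g}" by (auto simp: card_1_singleton_iff)
    then have *: "E \<union> F = {e, z, f, b, g}" using G EE by auto
    have Ann: "g \<in> Ann" using GAnn GG by auto
    have e: "e \<in> A" "f \<in> A" "m e e = z" "m f f = z" "m e f = 0" "m f e = 0"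
      using E EE by (auto simp: diagonal_on_def)
    show ?thesis
      by (intro exI[of _ A13_A01_pow2], rule isomorphic_table_explicit[OF _ _ _ refl, of e z f b g])
         (use * ind cardEF zb Ann e in \<open>auto simp: simps\<close>)
  next
    case 4
    then obtain e f g where EE: "E = {e, f, g}" "e \<noteq> f" "f \<noteq> g" "e \<noteq> g" by (auto simp: card_3_iff)
    have e: "e \<in> A" "f \<in> A" "g \<in> A" "m e e = z" "m f f = z" "m g g = z" "m e f = 0" "m f e = 0"
      "m e g = 0" "m g e = 0" "m f g = 0" "m g f = 0"
      using E EE by (auto simp: diagonal_on_def)
    obtain i :: 'k where i: "i * i = - 1"
      using nth_root_exists[of 2 "- 1 :: 'k"] by (auto simp: power2_eq_square)
    \<comment> \<open>isotropic vectors of the plane spanned by \<open>f, g\<close>, scaled to have product \<open>z\<close>\<close>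
    define u where "u = f + s i g"
    define v where "v = s (1 / 2) (f - s i g)"
    have uvA: "u \<in> A" "v \<in> A" using e by (auto simp: u_def v_def carrier_intros)
    have fg: "m (f + s i g) (f - s i g) = s 2 z"
    proof -
      have "m (f + s i g) (f - s i g) = z - s (i * i) z"
        using e by (simp add: bilinear carrier_intros)
      also have "\<dots> = s (1 + 1) z" unfolding i by (simp only: scale_left_distrib) simp
      finally show ?thesis by simp
    qed
    have uv: "m e u = 0" "m u e = 0" "m e v = 0" "m v e = 0" "m u u = 0" "m v v = 0" "m u v = z" "m v u = z"
    proof -
      show "m u v = z" using fg two_nonzero e by (simp add: u_def v_def bilinear carrier_intros)
      then show "m v u = z" using uvA mult_commute by simp
    qed (use e i in \<open>simp_all add: u_def v_def bilinear carrier_intros\<close>)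
    have 3: "u \<notin> span {b, z}"
      by (rule not_in_span_if_killed[of v]) (use uv uvA zb in \<open>auto simp: Ann_mult Ann_carrier\<close>)
    have 4: "v \<notin> span {u, b, z}"
      by (rule not_in_span_if_killed[of u]) (use uv uvA zb in \<open>auto simp: Ann_mult Ann_carrier\<close>)
    have 5: "e \<notin> span {v, u, b, z}"
      by (rule not_in_span_if_killed[of e]) (use e uv uvA zb in \<open>auto simp: Ann_mult Ann_carrier\<close>)
    have "{e, z, u, v, b} = {e, v, u, b, z}" by auto
    then show ?thesis
      using independent_5[OF zb(3,4) 3 4 5]
      by (intro exI[of _ A24_A01], intro isomorphic_table_explicit[OF _ _ _ refl, of e z u v b])
         (use e uv uvA zb in \<open>auto simp: simps\<close>)
  qed
qed

end

section \<open>Decompositions with nonzero products in both summands\<close>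

locale decomposed_cube_zero_algebra_5 = cube_zero_algebra_5 s A m
  for s :: "'k::alg_closed_field \<Rightarrow> 'v::ab_group_add \<Rightarrow> 'v" and A m +
  fixes B C :: "'v set"
  assumes subspace_B: "subspace B" and subspace_C: "subspace C"
    and B_carrier: "B \<subseteq> A" and C_carrier: "C \<subseteq> A"
    and mult_B: "x \<in> B \<Longrightarrow> y \<in> B \<Longrightarrow> m x y \<in> B" and mult_C: "x \<in> C \<Longrightarrow> y \<in> C \<Longrightarrow> m x y \<in> C"
    and mult_B_C: "x \<in> B \<Longrightarrow> y \<in> C \<Longrightarrow> m x y = 0"
    and B_Int_C: "B \<inter> C = {0}"
    and carrier_split: "x \<in> A \<Longrightarrow> \<exists>y\<in>B. \<exists>z\<in>C. x = y + z"
    and B_nonzero: "B \<noteq> {0}" and C_nonzero: "C \<noteq> {0}"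
begin

lemma mult_C_B: "x \<in> C \<Longrightarrow> y \<in> B \<Longrightarrow> m x y = 0"
  using mult_commute[of x y] mult_B_C[of y x] B_carrier C_carrier by auto

lemma swap: "decomposed_cube_zero_algebra_5 s A m C B"
proof unfold_locales
  fix x assume "x \<in> A"
  then show "\<exists>y\<in>C. \<exists>z\<in>B. x = y + z" using carrier_split[of x] by (metis add.commute)
qed (use subspace_B subspace_C B_carrier C_carrier mult_B mult_C mult_C_B B_Int_C B_nonzero C_nonzero
    in auto)

lemma B_C_zero: "x \<in> B \<Longrightarrow> x \<in> C \<Longrightarrow> x = 0"
  using B_Int_C by blast

text \<open>
  Elements of \<open>C\<close> are combinations of \<open>w, c, c c\<close>. Writing \<open>c w\<close> and \<open>w w\<close> in this form and
  multiplying by \<open>c\<close> and \<open>w\<close>, which gives zero, shows that both are multiples of \<open>c c\<close>. Subtracting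
  a multiple of \<open>c\<close> from \<open>w\<close> makes it orthogonal to \<open>c\<close>, and its square \<open>d (c c)\<close> can be normalised
  to zero or \<open>c c\<close>.
\<close>

lemma isomorphic_if_fifth_generator_in_C:
  assumes b: "b \<in> B" "m b b \<noteq> 0" and c: "c \<in> C" "m c c \<noteq> 0"
    and w: "w \<in> C" "w \<notin> span {b, m b b, c, m c c}"
  shows "\<exists>N. algebra_isomorphic s A m (*s) (UNIV :: ('k^5) set) (table_mult (products N))"
proof -
  let ?S = "{b, m b b, c, m c c}"
  have A: "b \<in> A" "c \<in> A" "w \<in> A" using b c w B_carrier C_carrier by auto
  have bc: "m b c = 0" "m c b = 0" using b c mult_B_C mult_C_B by auto
  have 1: "c \<notin> span {m c c}"
    by (rule not_in_span_if_killed[of c]) (use A c in \<open>auto simp: bilinear carrier_intros\<close>)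
  have "span {c, m c c} \<subseteq> C" using c mult_C by (intro span_minimal subspace_C) auto
  then have 2: "m b b \<notin> span {c, m c c}" using B_C_zero b mult_B by blast
  have 3: "b \<notin> span {m b b, c, m c c}"
    by (rule not_in_span_if_killed[of b]) (use A b bc in \<open>auto simp: bilinear carrier_intros\<close>)
  have ind: "independent (insert x ?S)" "card (insert x ?S) = 5" if "x \<notin> span ?S" for x
  proof -
    show "independent (insert x ?S)" "card (insert x ?S) = 5"
      using independent_5[OF c(2) 1 2 3 that] by simp_all
  qed
  have SA: "?S \<subseteq> A" using A by (auto simp: carrier_intros)
  have spanA: "span (insert w ?S) = A"
    using ind w(2) SA A by (intro span_eq_carrier) auto
  have C_coords: "\<exists>i j k. y = s i w + s j c + s k (m c c)" if y: "y \<in> C" for y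
  proof -
    have "y \<in> span (insert w ?S)" using spanA y C_carrier by auto
    then obtain i j k l n where
      eq: "y - s i w - s j b - s k (m b b) - s l c - s n (m c c) = 0"
      by (auto simp: span_breakdown_eq)
    have "y - s i w - s l c - s n (m c c) \<in> C"
      using y w c mult_C subspace_C by (intro subspace_diff subspace_scale) auto
    moreover have "s j b + s k (m b b) \<in> B"
      using b mult_B subspace_B by (intro subspace_add subspace_scale) auto
    moreover have "y - s i w - s l c - s n (m c c) = s j b + s k (m b b)"
      using eq by (simp add: algebra_simps)
    ultimately have "y - s i w - s l c - s n (m c c) = 0" using B_C_zero by metis
    then have "y = s i w + s l c + s n (m c c)" by (simp add: algebra_simps)
    then show ?thesis by blast
  qed
  obtain k where k: "m c w = s k (m c c)"
  proof -
    obtain i j k where eq: "m c w = s i w + s j c + s k (m c c)"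
      using C_coords mult_C c w by blast
    have "m c (m c w) = m c (s i w + s j c + s k (m c c))" using eq by simp
    also have "\<dots> = s i (m c w) + s j (m c c)" using A by (simp add: bilinear carrier_intros)
    finally have "m c (m c w) = s i (m c w) + s j (m c c)" .
    then have 0: "s i (m c w) + s j (m c c) = 0" using A by (simp add: bilinear)
    show thesis
    proof (cases "i = 0")
      case True
      then show ?thesis using 0 c eq that by simp
    next
      case False
      then show ?thesis using scale_solve[OF 0] that by blast
    qed
  qed
  obtain l where l: "m w w = s l (m c c)"
  proof -
    obtain i j n where eq: "m w w = s i w + s j c + s n (m c c)"
      using C_coords mult_C w by blast
    have "m c (m w w) = s i (m c w) + s j (m c c)" "m w (m w w) = s i (m w w) + s j (m c w)"
      using eq A by (simp_all add: bilinear carrier_intros mult_commute[of w c])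
    then have 0: "s i (m c w) + s j (m c c) = 0" "s i (m w w) + s (j * k) (m c c) = 0"
      using A k by (simp_all add: bilinear)
    show thesis
    proof (cases "i = 0")
      case True
      then show ?thesis using 0 c eq that by simp
    next
      case False
      then show ?thesis using scale_solve[OF 0(2)] that by blast
    qed
  qed
  define v where "v = w - s k c"
  have v: "v \<in> C" "v \<in> A" "m v c = 0" "m c v = 0"
    using A k w c by (auto simp: v_def bilinear carrier_intros mult_commute[of w c]
        subspace_C subspace_diff subspace_scale)
  have v_span: "v \<notin> span ?S"
  proof
    assume "v \<in> span ?S"
    moreover have "c \<in> span ?S" by (rule span_base) simp
    ultimately have "v + s k c \<in> span ?S" by (simp add: span_add span_scale)
    then show False using w by (simp add: v_def)
  qed
  \<comment> \<open>as \<open>v\<close> is orthogonal to \<open>c\<close>, its square is \<open>w v = w w - k (w c)\<close>\<close>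
  obtain d where d: "m v v = s d (m c c)"
  proof -
    have "m v v = m w v"
      using v A by (simp add: v_def bilinear carrier_intros)
    also have "\<dots> = s (l - k * k) (m c c)"
      using v A k l
      by (simp add: v_def bilinear carrier_intros mult_commute[of w c] scale_left_diff_distrib)
    finally show thesis using that by blast
  qed
  have zero: "m b x = 0" "m x b = 0" if "x \<in> C" for x
    using that b mult_B_C mult_C_B by auto
  show ?thesis
  proof (cases "d = 0")
    case True
    show ?thesis
    proof (intro exI[of _ A12_pow2_A01], rule isomorphic_table_explicit[OF _ _ _ refl])
      show "independent {b, m b b, c, m c c, v}" "card {b, m b b, c, m c c, v} = 5"
        using ind[OF v_span] by (simp_all add: insert_commute)
    qed (use A SA v d True b c zero in \<open>auto simp: forall_5 bilinear carrier_intros bc\<close>)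
  next
    case False
    then obtain r where r: "r ^ 2 = d" "r \<noteq> 0" using nth_root_exists[of 2 d] by fastforce
    define u where "u = s (1 / r) v"
    have u: "u \<in> C" "u \<in> A" "m u c = 0" "m c u = 0" "m u u = m c c"
      using v A r d by (auto simp: u_def bilinear carrier_intros subspace_C subspace_scale power2_eq_square)
    have u_span: "u \<notin> span ?S"
    proof
      assume "u \<in> span ?S"
      then have "s r u \<in> span ?S" by (intro span_scale)
      then show False using v_span r by (simp add: u_def)
    qed
    show ?thesis
    proof (intro exI[of _ A12_A13], rule isomorphic_table_explicit[OF _ _ _ refl])
      show "independent {b, m b b, c, m c c, u}" "card {b, m b b, c, m c c, u} = 5"
        using ind[OF u_span] by (simp_all add: insert_commute)
    qed (use A SA u b c zero in \<open>auto simp: forall_5 bilinear carrier_intros bc\<close>)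
  qed
qed

lemma summand_vector_outside_span:
  assumes S: "S \<subseteq> A" and "span S \<noteq> A"
  obtains w where "w \<in> B \<or> w \<in> C" "w \<notin> span S"
proof -
  obtain a where a: "a \<in> A" "a \<notin> span S" using assms span_carrier by blast
  obtain y z where yz: "y \<in> B" "z \<in> C" "a = y + z" using carrier_split[OF a(1)] by blast
  then have "y \<notin> span S \<or> z \<notin> span S" using a span_add by blast
  with yz that show thesis by blast
qed

text \<open>
  Four vectors do not span \<open>A\<close>, and of the two components of a vector outside their span at least
  one lies outside as well; so the fifth basis vector may be taken in \<open>B\<close> or in \<open>C\<close>.
\<close>

lemma classification_both_nontrivial:
  assumes b: "b \<in> B" "m b b \<noteq> 0" and c: "c \<in> C" "m c c \<noteq> 0"
  shows "\<exists>N. algebra_isomorphic s A m (*s) (UNIV :: ('k^5) set) (table_mult (products N))"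
proof -
  interpret sw: decomposed_cube_zero_algebra_5 s A m C B by (fact swap)
  let ?S = "{b, m b b, c, m c c}"
  have "?S \<subseteq> A" using b c B_carrier C_carrier mult_B mult_C by auto
  moreover have "span ?S \<noteq> A"
  proof
    assume "span ?S = A"
    then have "dim A \<le> card ?S" by (intro dim_le_card) auto
    also have "\<dots> \<le> 4" by (simp add: card_insert_if)
    finally show False using dim_carrier by simp
  qed
  ultimately obtain w where w: "w \<in> B \<or> w \<in> C" "w \<notin> span ?S"
    by (rule summand_vector_outside_span)
  then show ?thesis
    using isomorphic_if_fifth_generator_in_C[OF b c] sw.isomorphic_if_fifth_generator_in_C[OF c b]
    by (auto simp: insert_commute)
qed

section \<open>Decompositions with a summand of zero product\<close>

lemma product_in_C:
  assumes B0: "\<And>x y. x \<in> B \<Longrightarrow> y \<in> B \<Longrightarrow> m x y = 0" and xy: "x \<in> A" "y \<in> A"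
  shows "m x y \<in> C"
proof -
  obtain b c where x: "b \<in> B" "c \<in> C" "x = b + c" using carrier_split[OF xy(1)] by blast
  obtain b' c' where y: "b' \<in> B" "c' \<in> C" "y = b' + c'" using carrier_split[OF xy(2)] by blast
  have "b \<in> A" "c \<in> A" "b' \<in> A" "c' \<in> A" using x y B_carrier C_carrier by auto
  then have "m x y = m c c'" using x y by (simp add: bilinear carrier_intros mult_B_C mult_C_B B0)
  then show ?thesis using x y mult_C by simp
qed

lemma B_in_Ann:
  assumes B0: "\<And>x y. x \<in> B \<Longrightarrow> y \<in> B \<Longrightarrow> m x y = 0" and b: "b \<in> B"
  shows "b \<in> Ann"
proof -
  have "m b a = 0" if a: "a \<in> A" for a
  proof -
    obtain y z where yz: "y \<in> B" "z \<in> C" "a = y + z" using carrier_split[OF a] by blast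
    then show ?thesis using b B_carrier C_carrier by (simp add: bilinear subset_iff B0 mult_B_C)
  qed
  then show ?thesis using b B_carrier by (auto simp: Ann_def)
qed

text \<open>
  The annihilator contains \<open>b\<close> and two independent products \<open>p\<close>, \<open>q\<close>, so at most two further vectors
  \<open>x, y\<close> are needed. Were \<open>x x, x y, y y\<close> independent, then together with \<open>b\<close> they would give four
  annihilating basis vectors, and one remaining vector can only produce multiples of its own
  square, against the hypothesis that the products do not lie in a line. A linear relation between
  \<open>x x, x y, y y\<close> splits into linear factors, which are the desired generators if they are
  independent; if they are proportional, the factor has square zero and any combination of \<open>x, y\<close>
  independent of it serves as \<open>v\<close>.
\<close>

lemma generators_with_vanishing_product:
  assumes B0: "\<And>x y. x \<in> B \<Longrightarrow> y \<in> B \<Longrightarrow> m x y = 0" and b: "b \<in> B" "b \<noteq> 0"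
    and no_line: "\<And>z. \<exists>x\<in>A. \<exists>y\<in>A. \<forall>k. m x y \<noteq> s k z"
  obtains u v S where "u \<in> A" "v \<in> A" "A = span (insert u (insert v S))" "S \<subseteq> Ann"
    "m u v = 0 \<or> m u u = 0"
proof -
  note result = that
  have bAnn: "b \<in> Ann" using B_in_Ann[OF B0] b by blast
  obtain p where p: "p \<in> Ann" "p \<in> C" "p \<noteq> 0"
  proof -
    obtain x y where "x \<in> A" "y \<in> A" "m x y \<noteq> s 1 0" using no_line by metis
    then show thesis using that[of "m x y"] mult_in_Ann product_in_C[OF B0] by auto
  qed
  obtain q where q: "q \<in> Ann" "q \<in> C" "q \<notin> span {p}"
  proof -
    obtain x y where xy: "x \<in> A" "y \<in> A" "\<And>k. m x y \<noteq> s k p" using no_line by metis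
    then have "m x y \<notin> span {p}" by (auto simp: span_breakdown_eq)
    then show thesis using that[of "m x y"] mult_in_Ann product_in_C[OF B0] xy by auto
  qed
  have "span {q, p} \<subseteq> C" using p q by (intro span_minimal subspace_C) auto
  then have bpq: "b \<notin> span {q, p}" using B_C_zero b by blast
  have pA: "{b, q, p} \<subseteq> Ann" using p q bAnn by auto
  have ind_p: "independent {p}" "finite {p}" using p by simp_all
  note ind_q = independent_insert_card[OF ind_p q(3)]
  note ind_b = independent_insert_card[OF ind_q(1,2) bpq]
  have sub: "{b, q, p} \<subseteq> A" "A \<subseteq> A" "span A = A"
    using pA Ann_carrier by (auto simp: span_eq_iff[THEN iffD2, OF subspace_carrier])
  obtain T where T: "{b, q, p} \<subseteq> T" "T \<subseteq> A" "independent T" "span T = A" "card T = 5" "finite T"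
    by (rule extend_to_basis[OF ind_b(1) sub])
  have "card {b, q, p} = 3" using ind_b(3) ind_q(3) by simp
  then have "card (T - {b, q, p}) = 2" using T by (subst card_Diff_subset) auto
  then obtain x y where xy: "T - {b, q, p} = {x, y}" by (auto simp: card_2_iff)
  let ?S = "{b, q, p}"
  have T_eq: "T = insert x (insert y ?S)" using xy T(1) by blast
  then have xyA: "x \<in> A" "y \<in> A" and span_xy: "span (insert x (insert y ?S)) = A" using T by auto
  have dep: "m y y = 0 \<or> m x y \<in> span {m y y} \<or> m x x \<in> span {m x y, m y y}"
  proof (rule ccontr)
    assume "\<not> ?thesis"
    then have 1: "m y y \<noteq> 0" and 2: "m x y \<notin> span {m y y}" and 3: "m x x \<notin> span {m x y, m y y}"
      by auto
    let ?P = "{m x x, m x y, m y y}"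
    have "?P \<subseteq> Ann" using xyA mult_in_Ann by auto
    then have P: "insert b ?P \<subseteq> Ann" using bAnn by auto
    have "span ?P \<subseteq> C"
      using xyA product_in_C[OF B0] by (intro span_minimal subspace_C) auto
    then have 4: "b \<notin> span ?P" using B_C_zero b by blast
    have "m x x \<noteq> 0" using 3 span_zero by metis
    then have 5: "x \<notin> span (insert b ?P)"
      using P xyA Ann_carrier by (intro not_in_span_if_killed[of x]) (auto simp: Ann_mult)
    have "insert x (insert b ?P) \<subseteq> A" using P xyA Ann_carrier by auto
    then have spanA: "A = span (insert x (insert x (insert b ?P)))"
      using span_eq_carrier independent_5[OF 1 2 3 4 5] by simp
    obtain u v where uv: "u \<in> A" "v \<in> A" "\<And>k. m u v \<noteq> s k (m x x)" using no_line by metis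
    obtain i j k where "m u v = s i (m x x) + s j (m x x) + s k (m x x)"
      by (rule products_from_two_generators[OF spanA P xyA(1) xyA(1) uv(1,2)])
    then show False using uv(3)[of "i + j + k"] by (simp add: scale_left_distrib)
  qed
  have new: thesis if uv: "u \<in> A" "v \<in> A" "m u v = 0 \<or> m u u = 0"
    and gen: "\<exists>i j. x = s i u + s j v" "\<exists>i j. y = s i u + s j v" for u v
  proof (rule result)
    let ?R = "insert u (insert v ?S)"
    have uv_span: "s i u + s j v \<in> span ?R" for i j
      by (intro span_add span_scale span_base) auto
    have "insert x (insert y ?S) \<subseteq> span ?R"
      using gen uv_span span_superset[of ?R] by auto
    then have "A \<subseteq> span ?R" unfolding span_xy[symmetric] by (intro span_minimal) auto
    moreover have "?R \<subseteq> A" using uv pA Ann_carrier by auto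
    ultimately show "A = span ?R" using span_carrier by blast
  qed (use uv pA in auto)
  consider "m y y = 0" | k where "m x y = s k (m y y)"
    | k l where "m x x = s k (m x y) + s l (m y y)"
    using dep by (auto simp: span_breakdown_eq algebra_simps)
  then show thesis
  proof cases
    case 1
    show thesis
    proof (rule new[of y x])
      show "\<exists>i j. x = s i y + s j x" by (intro exI[of _ 0] exI[of _ 1]) simp
      show "\<exists>i j. y = s i y + s j x" by (intro exI[of _ 1] exI[of _ 0]) simp
    qed (use 1 xyA in auto)
  next
    case (2 k)
    show thesis
    proof (rule new[of "x - s k y" y])
      show "\<exists>i j. x = s i (x - s k y) + s j y" by (intro exI[of _ 1] exI[of _ k]) simp
      show "\<exists>i j. y = s i (x - s k y) + s j y" by (intro exI[of _ 0] exI[of _ 1]) simp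
    qed (use 2 xyA in \<open>auto simp: bilinear carrier_intros\<close>)
  next
    case (3 k l)
    \<comment> \<open>the roots \<open>r, t\<close> of \<open>X\<^sup>2 - k X - l\<close> give \<open>(x - r y) (x - t y) = 0\<close>\<close>
    obtain d where d: "d ^ 2 = (k / 2) ^ 2 + l" using nth_root_exists[of 2] by fastforce
    define r t where "r = k / 2 + d" and "t = k / 2 - d"
    have rt: "r + t = k" "r * t = - l"
    proof -
      show "r + t = k" using two_nonzero by (simp add: r_def t_def field_simps)
      have "r * t = (k / 2) ^ 2 - d ^ 2" by (simp add: r_def t_def algebra_simps power2_eq_square)
      then show "r * t = - l" using d by simp
    qed
    have "m (x - s r y) (x - s t y) = m x x - s (r + t) (m x y) + s (r * t) (m y y)"
      using xyA mult_commute[of y x]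
      by (simp add: bilinear carrier_intros scale_left_distrib scale_right_diff_distrib algebra_simps)
    then have 0: "m (x - s r y) (x - s t y) = 0" unfolding rt 3 by simp
    show thesis
    proof (cases "r = t")
      case True
      show thesis
      proof (rule new[of "x - s r y" y])
        show "\<exists>i j. x = s i (x - s r y) + s j y" by (intro exI[of _ 1] exI[of _ r]) simp
        show "\<exists>i j. y = s i (x - s r y) + s j y" by (intro exI[of _ 0] exI[of _ 1]) simp
      qed (use 0 True xyA in \<open>auto simp: carrier_intros\<close>)
    next
      case False
      define c where "c = 1 / (t - r)"
      have c: "c * (t - r) = 1" using False by (simp add: c_def)
      have y: "y = s c (x - s r y) + s (- c) (x - s t y)"
      proof -
        have "s c (x - s r y) + s (- c) (x - s t y) = s (c * (t - r)) y"
          by (simp add: scale_right_diff_distrib scale_left_diff_distrib algebra_simps)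
        then show ?thesis using c by simp
      qed
      show thesis
      proof (rule new[of "x - s r y" "x - s t y"])
        show "\<exists>i j. y = s i (x - s r y) + s j (x - s t y)" using y by blast
        have "x = (x - s r y) + s r y" by simp
        also have "\<dots> = (x - s r y) + s r (s c (x - s r y) + s (- c) (x - s t y))"
          using y by simp
        also have "\<dots> = s (1 + r * c) (x - s r y) + s (- (r * c)) (x - s t y)"
          by (simp only: scale_left_distrib scale_right_distrib scale_scale scale_one mult_minus_right
              add.assoc)
        finally show "\<exists>i j. x = s i (x - s r y) + s j (x - s t y)" by blast
      qed (use 0 xyA in \<open>auto simp: carrier_intros\<close>)
    qed
  qed
qed

text \<open>
  All products are combinations of \<open>u u, u v, v v\<close>, one of which is zero. The other two are
  independent because the products do not lie in a line, so together with \<open>u, v, b\<close> they form a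
  basis.
\<close>

lemma classification_products_not_in_line:
  assumes B0: "\<And>x y. x \<in> B \<Longrightarrow> y \<in> B \<Longrightarrow> m x y = 0" and b: "b \<in> B" "b \<noteq> 0"
    and no_line: "\<And>z. \<exists>x\<in>A. \<exists>y\<in>A. \<forall>k. m x y \<noteq> s k z"
  shows "\<exists>N. algebra_isomorphic s A m (*s) (UNIV :: ('k^5) set) (table_mult (products N))"
proof -
  have bAnn: "b \<in> Ann" using B_in_Ann[OF B0] b by blast
  obtain u v S where uv: "u \<in> A" "v \<in> A" and spanA: "A = span (insert u (insert v S))"
    and S: "S \<subseteq> Ann" and dich: "m u v = 0 \<or> m u u = 0"
    by (rule generators_with_vanishing_product[OF B0 b no_line])
  have vu: "m v u = m u v" using uv mult_commute by simp
  have bz: "m b u = 0" "m u b = 0" "m b v = 0" "m v b = 0" "m b b = 0" "b \<in> A"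
    using bAnn uv Ann_carrier by (auto simp: Ann_mult)
  have b_span: "b \<notin> span {m x y, m x' y'}" if "x \<in> A" "y \<in> A" "x' \<in> A" "y' \<in> A" for x y x' y'
  proof -
    have "span {m x y, m x' y'} \<subseteq> C"
      using that product_in_C[OF B0] by (intro span_minimal subspace_C) auto
    then show ?thesis using B_C_zero b by blast
  qed
  have not_line: "\<not> (\<forall>i j k. \<exists>l. s i (m u u) + s j (m u v) + s k (m v v) = s l z)" for z
  proof
    assume *: "\<forall>i j k. \<exists>l. s i (m u u) + s j (m u v) + s k (m v v) = s l z"
    obtain x y where xy: "x \<in> A" "y \<in> A" "\<And>k. m x y \<noteq> s k z" using no_line by metis
    obtain i j k where "m x y = s i (m u u) + s j (m u v) + s k (m v v)"
      by (rule products_from_two_generators[OF spanA S uv xy(1,2)])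
    then show False using * xy(3) by metis
  qed
  show ?thesis
  proof (cases "m u v = 0")
    case True
    have 1: "m u u \<noteq> 0" using not_line[of "m v v"] True by auto
    have 2: "m v v \<notin> span {m u u}"
    proof
      assume "m v v \<in> span {m u u}"
      then obtain k where "m v v = s k (m u u)" by (auto simp: span_breakdown_eq)
      then have "s i (m u u) + s j (m u v) + s l (m v v) = s (i + l * k) (m u u)" for i j l
        using True by (simp add: scale_left_distrib)
      then show False using not_line by blast
    qed
    then have v0: "m v v \<noteq> 0" using span_zero by metis
    have 3: "b \<notin> span {m v v, m u u}" using b_span uv by blast
    have 4: "v \<notin> span {b, m v v, m u u}"
      by (rule not_in_span_if_killed[of v])
         (use uv bz v0 in \<open>auto simp: bilinear carrier_intros\<close>)
    have 5: "u \<notin> span {v, b, m v v, m u u}"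
      by (rule not_in_span_if_killed[of u])
         (use uv bz 1 vu True in \<open>auto simp: bilinear carrier_intros\<close>)
    have "{u, m u u, v, m v v, b} = {u, v, b, m v v, m u u}" by auto
    then show ?thesis
      using independent_5[OF 1 2 3 4 5]
      by (intro exI[of _ A12_pow2_A01],
          intro isomorphic_table_explicit[OF _ _ _ refl, of u "m u u" v "m v v" b])
         (use uv bz vu True in \<open>auto simp: forall_5 bilinear carrier_intros Ann_mult bAnn\<close>)
  next
    case False
    then have uu: "m u u = 0" using dich by simp
    have 1: "m u v \<noteq> 0" by (fact False)
    have 2: "m v v \<notin> span {m u v}"
    proof
      assume "m v v \<in> span {m u v}"
      then obtain k where "m v v = s k (m u v)" by (auto simp: span_breakdown_eq)
      then have "s i (m u u) + s j (m u v) + s l (m v v) = s (j + l * k) (m u v)" for i j l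
        using uu by (simp add: scale_left_distrib)
      then show False using not_line by blast
    qed
    have 3: "b \<notin> span {m v v, m u v}" using b_span uv by blast
    have 4: "u \<notin> span {b, m v v, m u v}"
      by (rule not_in_span_if_killed[of v])
         (use uv bz 1 in \<open>auto simp: bilinear carrier_intros\<close>)
    have 5: "v \<notin> span {u, b, m v v, m u v}"
      by (rule not_in_span_if_killed[of u])
         (use uv bz 1 vu uu in \<open>auto simp: bilinear carrier_intros\<close>)
    have "{v, m v v, u, m u v, b} = {v, u, b, m v v, m u v}" by auto
    then show ?thesis
      using independent_5[OF 1 2 3 4 5]
      by (intro exI[of _ A14_A01],
          intro isomorphic_table_explicit[OF _ _ _ refl, of v "m v v" u "m u v" b])
         (use uv bz vu uu in \<open>auto simp: forall_5 bilinear carrier_intros Ann_mult bAnn\<close>)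
  qed
qed

text \<open>
  If all products lie in a line, this line may be taken inside \<open>C\<close>: it is spanned by a product, or
  any line of \<open>C\<close> will do when the product is zero. Then its generator is independent of \<open>b \<in> B\<close>.
\<close>

lemma classification_one_trivial:
  assumes B0: "\<And>x y. x \<in> B \<Longrightarrow> y \<in> B \<Longrightarrow> m x y = 0"
  shows "\<exists>N. algebra_isomorphic s A m (*s) (UNIV :: ('k^5) set) (table_mult (products N))"
proof -
  interpret sw: decomposed_cube_zero_algebra_5 s A m C B by (fact swap)
  obtain b where b: "b \<in> B" "b \<noteq> 0" using B_nonzero subspace_0[OF subspace_B] by blast
  show ?thesis
  proof (cases "\<exists>z. \<forall>x\<in>A. \<forall>y\<in>A. \<exists>k. m x y = s k z")
    case False
    then have no_line: "\<exists>x\<in>A. \<exists>y\<in>A. \<forall>k. m x y \<noteq> s k z" for z by metis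
    show ?thesis by (rule classification_products_not_in_line[OF B0 b no_line])
  next
    case True
    obtain z where z: "z \<in> C" "z \<in> Ann" "z \<noteq> 0"
      and line: "\<And>x y. x \<in> A \<Longrightarrow> y \<in> A \<Longrightarrow> \<exists>k. m x y = s k z"
    proof (cases "\<forall>x\<in>A. \<forall>y\<in>A. m x y = 0")
      case True
      obtain c where c: "c \<in> C" "c \<noteq> 0" using C_nonzero subspace_0[OF subspace_C] by blast
      show thesis
      proof (rule that[OF c(1) _ c(2)])
        show "c \<in> Ann" using True c C_carrier by (auto simp: Ann_def)
        show "\<exists>k. m x y = s k c" if "x \<in> A" "y \<in> A" for x y
          using True that by (intro exI[of _ 0]) simp
      qed
    next
      case False
      then obtain p q where pq: "p \<in> A" "q \<in> A" "m p q \<noteq> 0" by blast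
      obtain z where z: "\<And>x y. x \<in> A \<Longrightarrow> y \<in> A \<Longrightarrow> \<exists>k. m x y = s k z" using True by blast
      obtain k where k: "m p q = s k z" using z pq by blast
      then have "k \<noteq> 0" using pq by auto
      show thesis
      proof (rule that[of "m p q"])
        fix x y assume "x \<in> A" "y \<in> A"
        then obtain l where "m x y = s l z" using z by blast
        then have "m x y = s (l / k) (m p q)" using k \<open>k \<noteq> 0\<close> by simp
        then show "\<exists>k. m x y = s k (m p q)" ..
      qed (use pq mult_in_Ann product_in_C[OF B0] in auto)
    qed
    have "span {z} \<subseteq> C" using z by (intro span_minimal subspace_C) auto
    then have "b \<notin> span {z}" using B_C_zero b by blast
    then show ?thesis
      using classification_products_in_line[OF z(2) _ z(3) _ line] B_in_Ann[OF B0 b(1)] by blast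
  qed
qed

lemma classification:
  "\<exists>N. algebra_isomorphic s A m (*s) (UNIV :: ('k^5) set) (table_mult (products N))"
proof -
  interpret sw: decomposed_cube_zero_algebra_5 s A m C B by (fact swap)
  consider b c where "b \<in> B" "m b b \<noteq> 0" "c \<in> C" "m c c \<noteq> 0"
    | "\<And>b. b \<in> B \<Longrightarrow> m b b = 0" | "\<And>c. c \<in> C \<Longrightarrow> m c c = 0"
    by blast
  then show ?thesis
  proof cases
    case 1
    then show ?thesis by (rule classification_both_nontrivial)
  next
    case 2
    then show ?thesis
      by (rule classification_one_trivial[OF mult_zero_if_squares_zero[OF subspace_B B_carrier]])
  next
    case 3
    then show ?thesis
      by (rule sw.classification_one_trivial[OF mult_zero_if_squares_zero[OF subspace_C C_carrier]])
  qed
qed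

end

section \<open>Internal decompositions\<close>

lemma decomposition_into_ideals:
  fixes s :: "'k::alg_closed_field \<Rightarrow> 'v::ab_group_add \<Rightarrow> 'v"
  assumes A: "cube_zero_algebra_5 s A m" and dec: "decomposable s A m"
  obtains B C where "decomposed_cube_zero_algebra_5 s A m B C"
proof -
  interpret cube_zero_algebra_5 s A m by (fact A)
  interpret prod: module_prod s s ..
  obtain B mB C mC f where B: "nonassoc_algebra s B mB" and C: "nonassoc_algebra s C mC"
    and nz: "B \<noteq> {0}" "C \<noteq> {0}" and bij: "bij_betw f A (B \<times> C)"
    and f_add: "\<And>x y. x \<in> A \<Longrightarrow> y \<in> A \<Longrightarrow> f (x + y) = f x + f y"
    and f_scale: "\<And>c x. x \<in> A \<Longrightarrow> f (s c x) = prod.scale c (f x)"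
    and f_mult: "\<And>x y. x \<in> A \<Longrightarrow> y \<in> A \<Longrightarrow> f (m x y) = direct_sum_mult mB mC (f x) (f y)"
    using dec unfolding decomposable_def algebra_isomorphic_def by blast
  interpret B: nonassoc_algebra s B mB by (fact B)
  interpret C: nonassoc_algebra s C mC by (fact C)
  have B0: "0 \<in> B" and C0: "0 \<in> C"
    using B.subspace_carrier C.subspace_carrier subspace_0 by auto
  have mB0: "mB x 0 = 0" "mB 0 x = 0" if "x \<in> B" for x
    using that B0 B.mult_scale_left[of 0 x 0] B.mult_scale_right[of x 0 0] by simp_all
  have mC0: "mC x 0 = 0" "mC 0 x = 0" if "x \<in> C" for x
    using that C0 C.mult_scale_left[of 0 x 0] C.mult_scale_right[of x 0 0] by simp_all
  have f0: "f 0 = 0" using f_scale[of 0 0] carrier_0 by (simp add: prod.scale_def zero_prod_def)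
  have f_in: "fst (f x) \<in> B" "snd (f x) \<in> C" if "x \<in> A" for x
    using bij_betw_apply[OF bij that] by auto
  have f_inj: "x = y" if "x \<in> A" "y \<in> A" "f x = f y" for x y
    using bij that by (auto simp: bij_betw_def inj_on_def)
  have f_surj: "\<exists>x\<in>A. f x = (p, q)" if "p \<in> B" "q \<in> C" for p q
  proof -
    have "(p, q) \<in> f ` A" using bij that by (auto simp: bij_betw_def)
    then show ?thesis by (metis imageE)
  qed
  define B' C' where "B' = {x \<in> A. snd (f x) = 0}" and "C' = {x \<in> A. fst (f x) = 0}"
  have "decomposed_cube_zero_algebra_5 s A m B' C'"
  proof unfold_locales
    show "subspace B'" "subspace C'"
      by (auto intro!: subspaceI simp: B'_def C'_def carrier_intros f0 f_add f_scale prod.scale_def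
          split_def)
    show "B' \<subseteq> A" "C' \<subseteq> A" by (auto simp: B'_def C'_def)
    show "m x y \<in> B'" if "x \<in> B'" "y \<in> B'" for x y
      using that C0 mC0 by (auto simp: B'_def carrier_intros f_mult direct_sum_mult_def)
    show "m x y \<in> C'" if "x \<in> C'" "y \<in> C'" for x y
      using that B0 mB0 by (auto simp: C'_def carrier_intros f_mult direct_sum_mult_def)
    show "m x y = 0" if "x \<in> B'" "y \<in> C'" for x y
    proof (rule f_inj)
      show "f (m x y) = f 0"
        using that f_in mB0 mC0 f0
        by (auto simp: B'_def C'_def f_mult direct_sum_mult_def zero_prod_def)
    qed (use that in \<open>auto simp: B'_def C'_def carrier_intros\<close>)
    show "B' \<inter> C' = {0}"
    proof -
      have "x = 0" if "x \<in> A" "snd (f x) = 0" "fst (f x) = 0" for x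
        using that f0 carrier_0 by (intro f_inj) (auto simp: prod_eq_iff)
      then show ?thesis using f0 carrier_0 by (auto simp: B'_def C'_def)
    qed
    show "\<exists>y\<in>B'. \<exists>z\<in>C'. x = y + z" if x: "x \<in> A" for x
    proof -
      obtain y where y: "y \<in> A" "f y = (fst (f x), 0)" using f_surj[OF f_in(1)[OF x] C0] by blast
      obtain z where z: "z \<in> A" "f z = (0, snd (f x))" using f_surj[OF B0 f_in(2)[OF x]] by blast
      have "x = y + z" using x y z by (intro f_inj) (auto simp: carrier_intros f_add prod_eq_iff)
      then show ?thesis using y z by (auto simp: B'_def C'_def)
    qed
    show "B' \<noteq> {0}"
    proof -
      obtain p where p: "p \<in> B" "p \<noteq> 0" using nz B0 by blast
      obtain y where "y \<in> A" "f y = (p, 0)" using f_surj[OF p(1) C0] by blast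
      then have "y \<in> B'" "y \<noteq> 0" using f0 p by (auto simp: B'_def zero_prod_def)
      then show ?thesis by blast
    qed
    show "C' \<noteq> {0}"
    proof -
      obtain q where q: "q \<in> C" "q \<noteq> 0" using nz C0 by blast
      obtain z where "z \<in> A" "f z = (0, q)" using f_surj[OF B0 q(1)] by blast
      then have "z \<in> C'" "z \<noteq> 0" using f0 q by (auto simp: C'_def zero_prod_def)
      then show ?thesis by blast
    qed
  qed
  with that show thesis .
qed

section \<open>Invariants distinguishing the tables\<close>

definition table_Ann :: "listed_algebra \<Rightarrow> ('k::field^5) set" where
  "table_Ann N = {x. \<forall>y. table_mult (products N) x y = 0}"

text \<open>
  The annihilator of each table is a coordinate subspace; these are the coordinates that it leaves
  free.
\<close>

primrec Ann_support :: "listed_algebra \<Rightarrow> 5 set" where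
  "Ann_support A01_pow5 = UNIV"
| "Ann_support A12_A01_pow3 = {2, 3, 4, 5}"
| "Ann_support A13_A01_pow2 = {2, 4, 5}"
| "Ann_support A24_A01 = {2, 5}"
| "Ann_support A12_pow2_A01 = {2, 4, 5}"
| "Ann_support A12_A13 = {2, 4}"
| "Ann_support A14_A01 = {2, 4, 5}"

lemma table_Ann_eq: "table_Ann N = {x::'k::field^5. \<forall>i. i \<notin> Ann_support N \<longrightarrow> x $ i = 0}"
proof (intro set_eqI iffI)
  fix x :: "'k^5"
  assume "x \<in> table_Ann N"
  then have "table_mult (products N) x (axis 1 1) = 0" "table_mult (products N) x (axis 3 1) = 0"
    "table_mult (products N) x (axis 4 1) = 0" "table_mult (products N) x (axis 5 1) = 0"
    by (simp_all add: table_Ann_def)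
  then show "x \<in> {x. \<forall>i. i \<notin> Ann_support N \<longrightarrow> x $ i = 0}"
    by (cases N) (simp_all add: table_mult_def vec_eq_iff forall_5 axis_def)
next
  fix x :: "'k^5"
  assume "x \<in> {x. \<forall>i. i \<notin> Ann_support N \<longrightarrow> x $ i = 0}"
  then show "x \<in> table_Ann N"
    by (cases N) (simp_all add: table_Ann_def table_mult_def vec_eq_iff forall_5 axis_def)
qed

lemma dim_table_Ann: "vec.dim (table_Ann N :: ('k::field^5) set) = card (Ann_support N)"
  unfolding table_Ann_eq by (rule dim_substandard_cart)

definition table_products_in_line :: "'k::field itself \<Rightarrow> listed_algebra \<Rightarrow> bool" where
  "table_products_in_line _ N \<longleftrightarrow> (\<exists>z::'k^5. \<forall>x y. \<exists>c. table_mult (products N) x y = c *s z)"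

lemma table_products_in_line_iff:
  "N \<in> {A13_A01_pow2, A24_A01} \<Longrightarrow> table_products_in_line TYPE('k::field) N"
  "N \<in> {A12_pow2_A01, A12_A13, A14_A01} \<Longrightarrow> \<not> table_products_in_line TYPE('k::field) N"
proof -
  assume N: "N \<in> {A13_A01_pow2, A24_A01}"
  have "table_mult (products N) x y = (table_mult (products N) x y $ 2) *s axis 2 1" for x y :: "'k^5"
    using N by (auto simp: table_mult_def vec_eq_iff forall_5 axis_def)
  then show "table_products_in_line TYPE('k::field) N" unfolding table_products_in_line_def by blast
next
  assume N: "N \<in> {A12_pow2_A01, A12_A13, A14_A01}"
  show "\<not> table_products_in_line TYPE('k::field) N"
  proof
    assume "table_products_in_line TYPE('k) N"
    then obtain z :: "'k^5" where z: "\<And>x y. \<exists>c. table_mult (products N) x y = c *s z"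
      by (auto simp: table_products_in_line_def)
    obtain x y :: "'k^5" where xy: "table_mult (products N) x y = axis 4 1"
    proof
      show "table_mult (products N) (axis 3 1) (if N = A14_A01 then axis 1 1 else axis 3 1) =
          (axis 4 1 :: 'k^5)"
        using N by (auto simp: table_mult_def vec_eq_iff forall_5 axis_def)
    qed
    have "table_mult (products N) (axis 1 1) (axis 1 1) = (axis 2 1 :: 'k^5)"
      using N by (auto simp: table_mult_def vec_eq_iff forall_5 axis_def)
    then obtain c where c: "axis 2 1 = c *s z" using z by metis
    obtain d where d: "axis 4 1 = d *s z" using z xy by metis
    have "(axis 2 1 :: 'k^5) $ 2 = c * z $ 2" "(axis 2 1 :: 'k^5) $ 4 = c * z $ 4"
      "(axis 4 1 :: 'k^5) $ 4 = d * z $ 4"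
      unfolding c d by simp_all
    then show False by (auto simp: axis_def)
  qed
qed

text \<open>
  A vector outside the annihilator with square zero: this separates \<open>A\<^sub>1\<^sub>,\<^sub>2\<^sup>2 \<oplus> A\<^sub>0\<^sub>,\<^sub>1\<close> from
  \<open>A\<^sub>1\<^sub>,\<^sub>4 \<oplus> A\<^sub>0\<^sub>,\<^sub>1\<close>, whose annihilators have the same dimension and whose products both span a plane.
\<close>

definition table_null_vector :: "'k::field itself \<Rightarrow> listed_algebra \<Rightarrow> bool" where
  "table_null_vector _ N \<longleftrightarrow> (\<exists>x::'k^5. table_mult (products N) x x = 0 \<and> x \<notin> table_Ann N)"

lemma table_null_vector_A12_pow2_A01: "\<not> table_null_vector TYPE('k::field) A12_pow2_A01"
  by (auto simp: table_null_vector_def table_Ann_eq table_mult_def vec_eq_iff forall_5 axis_def)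

lemma table_null_vector_A14_A01: "table_null_vector TYPE('k::field) A14_A01"
  unfolding table_null_vector_def
  by (rule exI[of _ "axis 3 1"])
     (auto simp: table_Ann_eq table_mult_def vec_eq_iff forall_5 axis_def)

section \<open>The classification\<close>

lemma isomorphism_between_tables:
  fixes s :: "'k::field \<Rightarrow> 'v::ab_group_add \<Rightarrow> 'v"
  assumes A: "nonassoc_algebra s A m"
    and N: "algebra_isomorphic s A m (*s) (UNIV :: ('k^5) set) (table_mult (products N))"
    and N': "algebra_isomorphic s A m (*s) (UNIV :: ('k^5) set) (table_mult (products N'))"
  obtains h :: "'k^5 \<Rightarrow> 'k^5" where "bij h" "\<And>x y. h (x + y) = h x + h y" "\<And>c x. h (c *s x) = c *s h x"
    "\<And>x y. h (table_mult (products N) x y) = table_mult (products N') (h x) (h y)"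
proof -
  interpret nonassoc_algebra s A m by (fact A)
  obtain f :: "'v \<Rightarrow> 'k^5" where f: "bij_betw f A UNIV"
    "\<And>x y. x \<in> A \<Longrightarrow> y \<in> A \<Longrightarrow> f (x + y) = f x + f y"
    "\<And>c x. x \<in> A \<Longrightarrow> f (s c x) = c *s f x"
    "\<And>x y. x \<in> A \<Longrightarrow> y \<in> A \<Longrightarrow> f (m x y) = table_mult (products N) (f x) (f y)"
    using N unfolding algebra_isomorphic_def by blast
  obtain f' :: "'v \<Rightarrow> 'k^5" where f': "bij_betw f' A UNIV"
    "\<And>x y. x \<in> A \<Longrightarrow> y \<in> A \<Longrightarrow> f' (x + y) = f' x + f' y"
    "\<And>c x. x \<in> A \<Longrightarrow> f' (s c x) = c *s f' x"
    "\<And>x y. x \<in> A \<Longrightarrow> y \<in> A \<Longrightarrow> f' (m x y) = table_mult (products N') (f' x) (f' y)"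
    using N' unfolding algebra_isomorphic_def by blast
  define g where "g = inv_into A f"
  have g_bij: "bij_betw g UNIV A" unfolding g_def using f(1) by (rule bij_betw_inv_into)
  have g_in: "g x \<in> A" and fg: "f (g x) = x" for x
    using g_bij f(1) by (auto simp: bij_betw_def g_def f_inv_into_f)
  have eqI: "x = y" if "x \<in> A" "y \<in> A" "f x = f y" for x y
    using f(1) that by (auto simp: bij_betw_def inj_on_def)
  have closed: "x + y \<in> A" "s c x \<in> A" if "x \<in> A" "y \<in> A" for x y c
    using that subspace_carrier subspace_add subspace_scale by auto
  have g_add: "g (x + y) = g x + g y" for x y
    by (rule eqI) (simp_all add: g_in fg closed f)
  have g_scale: "g (c *s x) = s c (g x)" for c x
    by (rule eqI) (simp_all add: g_in fg closed[OF _ g_in] f)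
  have g_mult: "g (table_mult (products N) x y) = m (g x) (g y)" for x y
    by (rule eqI) (simp_all add: g_in fg mult_closed f)
  show thesis
  proof (rule that[of "f' \<circ> g"])
    show "bij (f' \<circ> g)" using g_bij f'(1) by (rule bij_betw_trans)
  qed (simp_all add: g_add g_scale g_mult g_in f')
qed

text \<open>
  The dimension of the annihilator, collinearity of all products, and existence of null vectors
  outside the annihilator are invariant under isomorphism and take different values on different
  tables.
\<close>

lemma isomorphic_tables_eq:
  fixes h :: "'k::field^5 \<Rightarrow> 'k^5"
  assumes bij: "bij h" and add: "\<And>x y. h (x + y) = h x + h y" and scale: "\<And>c x. h (c *s x) = c *s h x"
    and mult: "\<And>x y. h (table_mult (products N) x y) = table_mult (products N') (h x) (h y)"
  shows "N = N'"
proof -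
  have lin: "Vector_Spaces.linear (*s) (*s) h"
    by unfold_locales (simp_all add: add scale)
  have h0: "h x = 0 \<longleftrightarrow> x = 0" for x
    using scale[of 0 0] bij by (metis bij_pointE vector_space_over_itself.scale_zero_left vec.scale_zero_left)
  have surj: "\<exists>x. y = h x" for y using bij by (metis bij_pointE)
  have Ann: "h x \<in> table_Ann N' \<longleftrightarrow> x \<in> table_Ann N" for x
    unfolding table_Ann_def mem_Collect_eq by (metis mult surj h0)
  have "h ` table_Ann N = table_Ann N'" using Ann surj by (auto simp: image_iff) metis
  then have "vec.dim (table_Ann N' :: ('k^5) set) = vec.dim (table_Ann N :: ('k^5) set)"
    using vec.dim_image_eq[OF lin, of "table_Ann N"] bij
    by (metis bij_is_inj inj_on_subset subset_UNIV)
  then have 1: "card (Ann_support N) = card (Ann_support N')" by (simp add: dim_table_Ann)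
  have 2: "table_products_in_line TYPE('k) N \<longleftrightarrow> table_products_in_line TYPE('k) N'"
  proof
    assume "table_products_in_line TYPE('k) N"
    then obtain z :: "'k^5" where z: "\<And>x y. \<exists>c. table_mult (products N) x y = c *s z"
      by (auto simp: table_products_in_line_def)
    have "\<exists>c. table_mult (products N') x y = c *s h z" for x y
      by (metis z surj mult scale)
    then show "table_products_in_line TYPE('k) N'" by (auto simp: table_products_in_line_def)
  next
    assume "table_products_in_line TYPE('k) N'"
    then obtain z :: "'k^5" where z: "\<And>x y. \<exists>c. table_mult (products N') x y = c *s h z"
      using surj by (auto simp: table_products_in_line_def) metis
    have "\<exists>c. table_mult (products N) x y = c *s z" for x y
      using z[of "h x" "h y"] bij by (metis mult scale bij_pointE)
    then show "table_products_in_line TYPE('k) N" by (auto simp: table_products_in_line_def)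
  qed
  have 3: "table_null_vector TYPE('k) N \<longleftrightarrow> table_null_vector TYPE('k) N'"
    unfolding table_null_vector_def by (metis mult surj h0 Ann)
  note facts = table_products_in_line_iff[where 'k = 'k] table_null_vector_A12_pow2_A01[where 'k = 'k]
    table_null_vector_A14_A01[where 'k = 'k]
  have "card (UNIV :: 5 set) = 5" by simp
  then show ?thesis using 1 2 3 facts by (cases N; cases N') simp_all
qed

text \<open>
  By associativity and commutativity the three Jacobi summands coincide, so three times any triple
  product is zero.
\<close>

lemma cube_zero_if_associative_jacobi_jordan:
  fixes s :: "'k::alg_closed_field \<Rightarrow> 'v::ab_group_add \<Rightarrow> 'v"
  assumes char: "CHAR('k) \<noteq> 2" "CHAR('k) \<noteq> 3"
    and A: "jacobi_jordan_algebra s A m" and assoc: "associative_on A m"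
    and dim: "vector_space.dim s A = 5"
  shows "cube_zero_algebra_5 s A m"
proof -
  interpret jacobi_jordan_algebra s A m by (fact A)
  have char_prime: "of_nat p \<noteq> (0 :: 'k)" if "prime p" "CHAR('k) \<noteq> p" for p
    using that CHAR_not_1'[where 'a = 'k]
    by (auto simp: of_nat_eq_0_iff_char_dvd prime_nat_iff)
  have 2: "(2 :: 'k) \<noteq> 0" using char_prime[of 2] char by simp
  have 3: "(3 :: 'k) \<noteq> 0" using char_prime[of 3] char by simp
  show ?thesis
  proof unfold_locales
    fix x y z assume xyz: "x \<in> A" "y \<in> A" "z \<in> A"
    have "m y (m z x) = m (m y z) x" "m z (m x y) = m (m x y) z" "m (m y z) x = m x (m y z)"
      "m (m x y) z = m x (m y z)"
      using assoc xyz mult_commute mult_closed by (auto simp: associative_on_def)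
    then have "m x (m y z) + m x (m y z) + m x (m y z) = 0" using jacobi[OF xyz] by simp
    then have "s (1 + 1 + 1) (m x (m y z)) = 0" by (simp only: scale_left_distrib scale_one)
    then show "m x (m y z) = 0" using 3 by simp
  qed (use mult_commute 2 dim in auto)
qed

theorem proposition4p4:
  fixes s :: "'k::alg_closed_field \<Rightarrow> 'v::ab_group_add \<Rightarrow> 'v"
    and A :: "'v set" and m :: "'v \<Rightarrow> 'v \<Rightarrow> 'v"
  assumes "CHAR('k) \<noteq> 2" and "CHAR('k) \<noteq> 3"
    and "jacobi_jordan_algebra s A m"
    and "associative_on A m"
    and "decomposable s A m"
    and "vector_space.dim s A = 5"
  shows "\<exists>!N. algebra_isomorphic s A m
                (*s) (UNIV :: ('k^5) set) (table_mult (products N))"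
proof -
  have A: "cube_zero_algebra_5 s A m"
    by (rule cube_zero_if_associative_jacobi_jordan[OF assms(1-4,6)])
  obtain B C where "decomposed_cube_zero_algebra_5 s A m B C"
    by (rule decomposition_into_ideals[OF A assms(5)])
  then have ex: "\<exists>N. algebra_isomorphic s A m (*s) (UNIV :: ('k^5) set) (table_mult (products N))"
    by (rule decomposed_cube_zero_algebra_5.classification)
  have na: "nonassoc_algebra s A m" using A by (rule cube_zero_algebra_5.axioms(1))
  show ?thesis
  proof (rule ex_ex1I[OF ex])
    fix N N'
    assume NN': "algebra_isomorphic s A m (*s) (UNIV :: ('k^5) set) (table_mult (products N))"
      "algebra_isomorphic s A m (*s) (UNIV :: ('k^5) set) (table_mult (products N'))"
    obtain h :: "'k^5 \<Rightarrow> 'k^5" where "bij h" "\<And>x y. h (x + y) = h x + h y"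
      "\<And>c x. h (c *s x) = c *s h x"
      "\<And>x y. h (table_mult (products N) x y) = table_mult (products N') (h x) (h y)"
      by (rule isomorphism_between_tables[OF na NN']) blast
    then show "N = N'" by (rule isomorphic_tables_eq)
  qed
qed
end
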